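(* Let $X$ be any finite connected graph whose number of edges is not equal to its number of vertices, with vertices labeled $v_1,\dots,v_n$ such that $v_1$ is adjacent to $v_2$. Let $G=\langle\tau\rangle$ be the cyclic group of order $d$, let $\alpha$ be the single voltage assignment on $X$ with values in $G$, and let $Y$ be the resulting derived graph, assumed to be connected. Let $K$ be the greatest common divisor of the (integer) coefficients of the reduced Stickelberger element $\Theta_{Y/X}\in\mathbb Z[G]$. Then $$|\mathcal J(Y)|=|\mathcal J(X)|\cdot|K|^{d-1}d.$$
   Context: Graphs are simple (no loops or multiple edges). For a finite connected graph $X$ with Laplacian $L=D-A$ (degree matrix minus adjacency matrix), the Jacobian $\mathcal J(X)$ is the cokernel of a reduced Laplacian (the matrix obtained from $L$ by deleting the row and column of one vertex); it is a finite abelian group. Single voltage assignment: $\alpha_{1,2}=\tau$, $\alpha_{2,1}=\tau^{-1}$, and $\alpha_{i,j}=1$ (the identity of $G$) for every other ordered pair $(i,j)$ with $v_i$ adjacent to $v_j$. The derived graph $Y$ has vertex set $\{v_{i,g}:1\le i\le n,\ g\in G\}$, and $v_{i,g}$ is adjacent to $v_{j,h}$ if and only if $v_i$ is adjacent to $v_j$ in $X$ and $h=g\alpha_{i,j}$. The voltage adjacency matrix $A_\alpha$ is the $n\times n$ matrix over the integral group ring $\mathbb Z[G]$ with $(i,j)$ entry $\alpha_{i,j}$ if $v_i,v_j$ are adjacent and $0$ otherwise. With $D_X$ the diagonal degree matrix of $X$, the reduced Stickelberger element is $\Theta_{Y/X}=\det(D_X-A_\alpha)\in\mathbb Z[G]$;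 as an element of $\mathbb Z[G]$ it is a linear combination of the elements of $G$ with integer coefficients.
   Formalization: The order d is assumed to be different from 2: for d = 2 the stated formula is always too large by a factor 2 (for X = K4 it gives 512, while |J(Y)| = 256). *)

theory Defs
  imports
    "HOL-Algebra.Elementary_Groups"
    "HOL-Algebra.Free_Abelian_Groups"
    "Graph_Theory.Graph_Theory"
    "Jordan_Normal_Form.Determinant"
begin

text \<open>
  A finite simple graph is a \<open>pair_graph\<close>: a finite loop-free symmetric set of arcs \<open>(u, w)\<close>.
  Every edge occurs there as two opposite arcs, so edges are counted as unordered pairs, and the
  degree of a vertex is its out-degree.
\<close>

definition edge_set :: "'a pair_pre_digraph \<Rightarrow> 'a set set" where
  "edge_set X = (\<lambda>(u, w). {u, w}) ` parcs X"

definition degree_matrix :: "'a pair_pre_digraph \<Rightarrow> 'a \<Rightarrow> 'a \<Rightarrow> int" where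
  "degree_matrix X u w = (if u = w then int (out_degree (with_proj X) u) else 0)"

definition adjacency_matrix :: "'a pair_pre_digraph \<Rightarrow> 'a \<Rightarrow> 'a \<Rightarrow> int" where
  "adjacency_matrix X u w = (if (u, w) \<in> parcs X then 1 else 0)"

definition laplacian :: "'a pair_pre_digraph \<Rightarrow> 'a \<Rightarrow> 'a \<Rightarrow> int" where
  "laplacian X u w = degree_matrix X u w - adjacency_matrix X u w"

text \<open>
  For a finite set \<open>S\<close> and an integer matrix \<open>M\<close> with rows and columns indexed by \<open>S\<close>, the
  homomorphism \<open>x \<mapsto> M x\<close> of the free abelian group \<open>\<int>\<^sup>S\<close> has the following image, and the cokernel
  is the quotient by it.  Values of \<open>M\<close> outside \<open>S \<times> S\<close> are irrelevant.
\<close>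

definition matrix_image :: "'a set \<Rightarrow> ('a \<Rightarrow> 'a \<Rightarrow> int) \<Rightarrow> ('a \<Rightarrow>\<^sub>0 int) set" where
  "matrix_image S M =
     {y \<in> carrier (free_Abelian_group S).
        \<exists>x \<in> carrier (free_Abelian_group S).
          \<forall>s\<in>S. Poly_Mapping.lookup y s = (\<Sum>t\<in>S. M s t * Poly_Mapping.lookup x t)}"

definition cokernel :: "'a set \<Rightarrow> ('a \<Rightarrow> 'a \<Rightarrow> int) \<Rightarrow> ('a \<Rightarrow>\<^sub>0 int) set monoid" where
  "cokernel S M = free_Abelian_group S Mod matrix_image S M"

text \<open>
  The deleted vertex \<open>r\<close> is a parameter; for a connected graph the isomorphism type does not
  depend on it.
\<close>

definition jacobian :: "'a pair_pre_digraph \<Rightarrow> 'a \<Rightarrow> ('a \<Rightarrow>\<^sub>0 int) set monoid" where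
  "jacobian X r = cokernel (pverts X - {r}) (laplacian X)"

text \<open>
  The voltage group \<open>G\<close> is the whole of a type \<open>'g\<close> of class \<open>ab_group_add\<close>, so it is written
  additively: the identity is \<open>0\<close> and the inverse of \<open>\<tau>\<close> is \<open>- \<tau>\<close>.  Then \<open>'g \<Rightarrow>\<^sub>0 int\<close> with its
  convolution product is the integral group ring \<open>\<int>[G]\<close>, in which \<open>Poly_Mapping.single g 1\<close> is the
  group element \<open>g\<close> and \<open>Poly_Mapping.lookup a g\<close> is the coefficient of \<open>g\<close> in \<open>a\<close>.
\<close>

definition additive_group :: "'g::ab_group_add monoid" where
  "additive_group = \<lparr>carrier = UNIV, monoid.mult = (+), one = 0\<rparr>"

text \<open>
  Vertices of \<open>X\<close> are labelled by a bijection \<open>v\<close> from \<open>{1..n}\<close>; voltages are indexed by labels.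
\<close>

definition single_voltage :: "'g::ab_group_add \<Rightarrow> nat \<Rightarrow> nat \<Rightarrow> 'g" where
  "single_voltage \<tau> i j =
     (if i = 1 \<and> j = 2 then \<tau> else if i = 2 \<and> j = 1 then - \<tau> else 0)"

definition derived_graph ::
  "'a pair_pre_digraph \<Rightarrow> nat \<Rightarrow> (nat \<Rightarrow> 'a) \<Rightarrow> (nat \<Rightarrow> nat \<Rightarrow> 'g::ab_group_add)
     \<Rightarrow> (nat \<times> 'g) pair_pre_digraph" where
  "derived_graph X n v \<alpha> =
     \<lparr>pverts = {1..n} \<times> UNIV,
      parcs = {((i, g), (j, h)) | i g j h.
                 i \<in> {1..n} \<and> j \<in> {1..n} \<and> (v i, v j) \<in> parcs X \<and> h = g + \<alpha> i j}\<rparr>"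

text \<open>
  The rows and columns of the library's matrices are numbered from \<open>0\<close>, hence \<open>Suc\<close> below.
\<close>

definition group_ring_degree_mat ::
  "'a pair_pre_digraph \<Rightarrow> nat \<Rightarrow> (nat \<Rightarrow> 'a) \<Rightarrow> ('g::ab_group_add \<Rightarrow>\<^sub>0 int) mat" where
  "group_ring_degree_mat X n v =
     mat n n (\<lambda>(i, j). of_int (degree_matrix X (v (Suc i)) (v (Suc j))))"

definition voltage_adjacency_mat ::
  "'a pair_pre_digraph \<Rightarrow> nat \<Rightarrow> (nat \<Rightarrow> 'a) \<Rightarrow> (nat \<Rightarrow> nat \<Rightarrow> 'g::ab_group_add)
     \<Rightarrow> ('g \<Rightarrow>\<^sub>0 int) mat" where
  "voltage_adjacency_mat X n v \<alpha> =
     mat n n (\<lambda>(i, j). if (v (Suc i), v (Suc j)) \<in> parcs X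
                       then Poly_Mapping.single (\<alpha> (Suc i) (Suc j)) 1 else 0)"

definition reduced_stickelberger ::
  "'a pair_pre_digraph \<Rightarrow> nat \<Rightarrow> (nat \<Rightarrow> 'a) \<Rightarrow> (nat \<Rightarrow> nat \<Rightarrow> 'g::ab_group_add)
     \<Rightarrow> 'g \<Rightarrow>\<^sub>0 int" where
  "reduced_stickelberger X n v \<alpha> =
     det (group_ring_degree_mat X n v - voltage_adjacency_mat X n v \<alpha>)"

text \<open>
  The gcd ranges over the coefficients of all elements of \<open>G\<close>; coefficients equal to \<open>0\<close> do not
  change it.  For the zero element it is \<open>0\<close>.

  Pitfall: with the single voltage assignment, \<open>\<Theta> = c (2 - \<tau> - \<tau>\<^sup>-\<^sup>1)\<close> for an integer \<open>c\<close>.  If \<open>G\<close> has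
  order \<open>2\<close>, then \<open>\<tau> = \<tau>\<^sup>-\<^sup>1\<close>, the two terms collapse to \<open>2 c (1 - \<tau>)\<close>, and the gcd of the coefficients
  is \<open>2 \<bar>c\<bar>\<close> instead of \<open>\<bar>c\<bar>\<close>.  The class number formula \<open>\<bar>J(Y)\<bar> = \<bar>J(X)\<bar> \<bar>K\<bar>\<^sup>d\<^sup>-\<^sup>1 d\<close> is then off by a
  factor of \<open>2\<close>: the complete graph on four vertices has \<open>\<bar>J(X)\<bar> = 16\<close>, \<open>\<Theta> = 16 - 16 \<tau>\<close> and
  \<open>\<bar>J(Y)\<bar> = 256\<close>, whereas \<open>16 * 16 * 2 = 512\<close>.  So it can only be asserted for orders other than \<open>2\<close>.
\<close>

definition coeff_gcd :: "('g \<Rightarrow>\<^sub>0 int) \<Rightarrow> int" where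
  "coeff_gcd a = Gcd (range (Poly_Mapping.lookup a))"

end

theory Submission
  imports Defs "HOL-Algebra.Multiplicative_Group"
begin

text \<open>
  The order of a cokernel is the absolute value of the determinant, so the claim compares two reduced
  Laplacians.  Let \<open>\<kappa>\<close> be the determinant of the Laplacian of \<open>X\<close> reduced at \<open>v\<^sub>1\<close>.  Both nontrivial voltages
  sit in row or column 1, so the part of \<open>Y\<close> away from the fibre of \<open>v\<^sub>1\<close> consists of \<open>d\<close> disjoint copies
  of \<open>X - v\<^sub>1\<close>, with determinant \<open>\<kappa>\<^sup>d\<close>.  Eliminating it, with the denominator \<open>\<kappa>\<close> cleared, leaves the
  matrix with entries \<open>\<theta> (h - g)\<close> on the fibre.  The same elimination over \<open>\<int>[G]\<close> shows \<open>\<Theta> = \<theta>\<close>, and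
  \<open>\<theta> = c (2 - \<tau> - \<tau>\<^sup>-\<^sup>1)\<close> because the rows of the Laplacian sum to zero.  So deleting one vertex of the
  fibre leaves \<open>c\<close> times the reduced Laplacian of the \<open>d\<close>-cycle, of determinant \<open>c\<^sup>d\<^sup>-\<^sup>1 d\<close>, and comparing
  powers of \<open>\<kappa> \<noteq> 0\<close> gives \<open>\<kappa> c\<^sup>d\<^sup>-\<^sup>1 d\<close> for \<open>Y\<close>, where \<open>\<bar>c\<bar> = \<bar>K\<bar>\<close> for \<open>d \<ge> 3\<close>.
\<close>

section \<open>Determinants over finite index sets\<close>

text \<open>The Leibniz formula over an index set shared by rows and columns: no ordering has to be
  chosen, and a vertex set such as \<open>W \<times> UNIV\<close> can be cut into blocks
  directly.\<close>

definition fdet :: "'i set \<Rightarrow> ('i \<Rightarrow> 'i \<Rightarrow> 'b::comm_ring_1) \<Rightarrow> 'b" where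
  "fdet S M = (\<Sum>p | p permutes S. of_int (sign p) * (\<Prod>i\<in>S. M i (p i)))"

lemma fdet_cong:
  assumes "\<And>i j. i \<in> S \<Longrightarrow> j \<in> S \<Longrightarrow> M i j = N i j"
  shows "fdet S M = fdet S N"
  unfolding fdet_def
  by (intro sum.cong refl arg_cong2[where f="(*)"] prod.cong assms)
     (auto simp: permutes_in_image)

lemma fdet_empty [simp]: "fdet {} M = 1"
  by (simp add: fdet_def)

lemma fdet_singleton [simp]: "fdet {a} M = M a a"
  by (simp add: fdet_def)

lemma bij_betw_map_permutation:
  assumes "bij_betw f A B"
  shows "bij_betw (map_permutation A f) {p. p permutes A} {p. p permutes B}"
proof (rule bij_betw_byWitness[where f' = "map_permutation B (inv_into A f)"])
  have inv: "bij_betw (inv_into A f) B A"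
    using assms by (rule bij_betw_inv_into)
  show "\<forall>p\<in>{p. p permutes A}. map_permutation B (inv_into A f) (map_permutation A f p) = p"
    using map_permutation_compose_inv[OF assms] assms
    by (auto simp: bij_betw_def)
  show "\<forall>p\<in>{p. p permutes B}. map_permutation A f (map_permutation B (inv_into A f) p) = p"
    using map_permutation_compose_inv[OF inv, where g = f] assms
    by (auto simp: bij_betw_def f_inv_into_f)
  show "map_permutation A f ` {p. p permutes A} \<subseteq> {p. p permutes B}"
    using map_permutation_permutes[OF assms] by auto
  show "map_permutation B (inv_into A f) ` {p. p permutes B} \<subseteq> {p. p permutes A}"
    using map_permutation_permutes[OF inv] by auto
qed

text \<open>Conjugation by \<open>f\<close> matches the permutations of \<open>A\<close> with those
  of \<open>B\<close>, keeps their signs and only reorders the factors of each product.\<close>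

lemma fdet_reindex:
  assumes f: "bij_betw f A B" and fin: "finite A"
  shows "fdet B M = fdet A (\<lambda>i j. M (f i) (f j))"
proof -
  have inj: "inj_on f A" using f by (simp add: bij_betw_def)
  have "fdet B M = (\<Sum>p | p permutes A.
      of_int (sign (map_permutation A f p)) * (\<Prod>i\<in>B. M i (map_permutation A f p i)))"
    unfolding fdet_def using bij_betw_map_permutation[OF f] 
    by (rule sum.reindex_bij_betw[symmetric])
  also have "\<dots> = fdet A (\<lambda>i j. M (f i) (f j))"
    unfolding fdet_def
  proof (intro sum.cong refl arg_cong2[where f="(*)"])
    fix p assume p: "p \<in> {p. p permutes A}"
    show "of_int (sign (map_permutation A f p)) = (of_int (sign p) :: 'c)"
      using p by (simp add: sign_map_permutation[OF inj _ fin])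
    have "(\<Prod>i\<in>B. M i (map_permutation A f p i)) = (\<Prod>i\<in>A. M (f i) (map_permutation A f p (f i)))"
      using f by (rule prod.reindex_bij_betw[symmetric])
    then show "(\<Prod>i\<in>B. M i (map_permutation A f p i)) = (\<Prod>i\<in>A. M (f i) (f (p i)))"
      by (simp add: map_permutation_apply[OF inj])
  qed
  finally show ?thesis .
qed

section \<open>Transfer to matrices with numbered rows and columns\<close>

definition index_mat :: "(nat \<Rightarrow> 'i) \<Rightarrow> nat \<Rightarrow> ('i \<Rightarrow> 'i \<Rightarrow> 'b) \<Rightarrow> 'b mat" where
  "index_mat f n M = mat n n (\<lambda>(i, j). M (f i) (f j))"

lemma index_mat_carrier [simp]: "index_mat f n M \<in> carrier_mat n n"
  by (simp add: index_mat_def)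

lemma fdet_eq_det:
  assumes "bij_betw f {0..<n} S"
  shows "fdet S M = det (index_mat f n M)"
proof -
  have "fdet S M = fdet {0..<n} (\<lambda>i j. M (f i) (f j))"
    using assms by (rule fdet_reindex) simp
  also have "\<dots> = det (index_mat f n M)"
    unfolding fdet_def Determinant.det_def index_mat_def
    by (auto intro!: sum.cong prod.cong simp: permutes_in_image)
  finally show ?thesis .
qed

lemma fdet_mult:
  assumes "finite S"
  shows "fdet S (\<lambda>i j. \<Sum>k\<in>S. M i k * N k j) = fdet S M * fdet S N"
proof -
  obtain f where f: "bij_betw f {0..<card S} S"
    using ex_bij_betw_nat_finite[OF assms] by blast
  have "index_mat f (card S) (\<lambda>i j. \<Sum>k\<in>S. M i k * N k j)
      = index_mat f (card S) M * index_mat f (card S) N"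
    by (rule eq_matI)
       (auto simp: index_mat_def scalar_prod_def sum.reindex_bij_betw[OF f, symmetric])
  then show ?thesis
    by (simp add: fdet_eq_det[OF f] det_mult[where n = "card S"])
qed

lemma fdet_transpose:
  assumes "finite S"
  shows "fdet S (\<lambda>i j. M j i) = fdet S M"
proof -
  obtain f where f: "bij_betw f {0..<card S} S"
    using ex_bij_betw_nat_finite[OF assms] by blast
  have "index_mat f (card S) (\<lambda>i j. M j i) = transpose_mat (index_mat f (card S) M)"
    by (rule eq_matI) (auto simp: index_mat_def)
  then show ?thesis
    by (simp add: fdet_eq_det[OF f] det_transpose[where n = "card S"])
qed

text \<open>Without division the adjugate stands in for the inverse, at the price of the scalar
  \<open>fdet S M\<close>. It is carried over from numbered matrices along \<open>f\<close> and its
  inverse \<open>g\<close>.\<close>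

lemma fdet_adjugate:
  assumes "finite S"
  obtains N where
    "\<And>i j. i \<in> S \<Longrightarrow> j \<in> S \<Longrightarrow> (\<Sum>k\<in>S. M i k * N k j) = (if i = j then fdet S M else 0)"
    "\<And>i j. i \<in> S \<Longrightarrow> j \<in> S \<Longrightarrow> (\<Sum>k\<in>S. N i k * M k j) = (if i = j then fdet S M else 0)"
proof -
  obtain f where f: "bij_betw f {0..<card S} S"
    using ex_bij_betw_nat_finite[OF assms] by blast
  define n where "n = card S"
  note f = f[folded n_def]
  define g where "g = inv_into {0..<n} f"
  have g: "g i < n" "f (g i) = i" if "i \<in> S" for i
    using that f bij_betw_inv_into[OF f] bij_betw_inv_into_right[OF f]
    by (auto simp: g_def bij_betw_def)
  have gf: "g (f k) = k" if "k < n" for k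
    using that bij_betw_inv_into_left[OF f] by (simp add: g_def)
  define A where "A = index_mat f n M"
  define N where "N i j = adj_mat A $$ (g i, g j)" for i j
  have A: "A \<in> carrier_mat n n" by (simp add: A_def)
  note adj = adj_mat[OF A]
  have fdet: "fdet S M = Determinant.det A"
    unfolding A_def by (rule fdet_eq_det[OF f])
  have Aij: "A $$ (g i, k) = M i (f k)" "A $$ (k, g i) = M (f k) i" if "i \<in> S" "k < n" for i k
    using that g by (auto simp: A_def index_mat_def)
  have 1: "(\<Sum>k\<in>S. M i k * N k j) = (if i = j then fdet S M else 0)" if "i \<in> S" "j \<in> S" for i j
  proof -
    have "(\<Sum>k\<in>S. M i k * N k j) = (\<Sum>k = 0..<n. A $$ (g i, k) * adj_mat A $$ (k, g j))"
      unfolding sum.reindex_bij_betw[OF f, symmetric]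
      by (rule sum.cong) (use that in \<open>auto simp: N_def Aij gf\<close>)
    also have "\<dots> = (A * adj_mat A) $$ (g i, g j)"
      using g that A adj(1) by (auto simp: scalar_prod_def intro!: sum.cong)
    also have "\<dots> = (if i = j then fdet S M else 0)"
      using g[OF that(1)] g[OF that(2)] by (auto simp: adj fdet)
    finally show ?thesis .
  qed
  have 2: "(\<Sum>k\<in>S. N i k * M k j) = (if i = j then fdet S M else 0)" if "i \<in> S" "j \<in> S" for i j
  proof -
    have "(\<Sum>k\<in>S. N i k * M k j) = (\<Sum>k = 0..<n. adj_mat A $$ (g i, k) * A $$ (k, g j))"
      unfolding sum.reindex_bij_betw[OF f, symmetric]
      by (rule sum.cong) (use that in \<open>auto simp: N_def Aij gf\<close>)
    also have "\<dots> = (adj_mat A * A) $$ (g i, g j)"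
      using g that A adj(1) by (auto simp: scalar_prod_def intro!: sum.cong)
    also have "\<dots> = (if i = j then fdet S M else 0)"
      using g[OF that(1)] g[OF that(2)] by (auto simp: adj fdet)
    finally show ?thesis .
  qed
  show thesis using 1 2 by (rule that)
qed

text \<open>Reduces the nonvanishing of a determinant to the absence of nonzero kernel vectors; over
  an integral domain such a vector can be taken in the domain itself.\<close>

lemma fdet_eq_0_kernel:
  fixes M :: "'i \<Rightarrow> 'i \<Rightarrow> 'b::idom"
  assumes fin: "finite S" and 0: "fdet S M = 0"
  obtains w i where "i \<in> S" "w i \<noteq> 0" "\<And>i. i \<in> S \<Longrightarrow> (\<Sum>j\<in>S. M i j * w j) = 0"
proof -
  obtain f where f: "bij_betw f {0..<card S} S"
    using ex_bij_betw_nat_finite[OF fin] by blast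
  define n where "n = card S"
  note f = f[folded n_def]
  define g where "g = inv_into {0..<n} f"
  have g: "g i < n" "f (g i) = i" if "i \<in> S" for i
    using that f bij_betw_inv_into[OF f] bij_betw_inv_into_right[OF f]
    by (auto simp: g_def bij_betw_def)
  have gf: "g (f k) = k" if "k < n" for k
    using that bij_betw_inv_into_left[OF f] by (simp add: g_def)
  define A where "A = index_mat f n M"
  have A: "A \<in> carrier_mat n n" by (simp add: A_def)
  have "Determinant.det A = 0"
    using 0 by (simp add: fdet_eq_det[OF f] A_def)
  then obtain v where v: "v \<in> carrier_vec n" "v \<noteq> 0\<^sub>v n" "A *\<^sub>v v = 0\<^sub>v n"
    using det_0_iff_vec_prod_zero[OF A] by blast
  obtain k where k: "k < n" "v $ k \<noteq> 0"
    using v by (metis carrier_vecD eq_vecI index_zero_vec)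
  have "(\<Sum>j\<in>S. M i j * v $ g j) = 0" if "i \<in> S" for i
  proof -
    have "(\<Sum>j\<in>S. M i j * v $ g j) = (A *\<^sub>v v) $ g i"
      unfolding sum.reindex_bij_betw[OF f, symmetric]
      using g[OF that] v(1) by (auto simp: A_def index_mat_def scalar_prod_def gf intro!: sum.cong)
    then show ?thesis using v g[OF that] by simp
  qed
  moreover have "f k \<in> S" using k f by (auto simp: bij_betw_def)
  ultimately show thesis
    using that[of "f k" "\<lambda>i. v $ g i"] k gf by auto
qed

section \<open>Block matrices and Schur complements\<close>

lemma fdet_block_triangular:
  assumes fin: "finite A" "finite B" and disj: "A \<inter> B = {}"
    and zero: "\<And>b a. b \<in> B \<Longrightarrow> a \<in> A \<Longrightarrow> M b a = 0"
  shows "fdet (A \<union> B) M = fdet A M * fdet B M"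
proof -
  let ?h = "\<lambda>(p, q). p \<circ> q"
  let ?PA = "{p. p permutes A}" and ?PB = "{p. p permutes B}"
  let ?t = "\<lambda>r. of_int (sign r) * (\<Prod>i\<in>A \<union> B. M i (r i))"
  have onA: "(p \<circ> q) a = p a" if "q permutes B" "a \<in> A" for p q a
  proof -
    have "a \<notin> B" using that disj by auto
    then show ?thesis using that by (simp add: permutes_not_in)
  qed
  have onB: "(p \<circ> q) b = q b" if "p permutes A" "q permutes B" "b \<in> B" for p q b
  proof -
    have "q b \<notin> A" using that disj permutes_in_image[OF that(2), of b] by auto
    then show ?thesis using that by (simp add: permutes_not_in)
  qed
  have perm: "p \<circ> q permutes A \<union> B" if "p permutes A" "q permutes B" for p q
    using permutes_compose[OF permutes_subset[OF that(2)] permutes_subset[OF that(1)], of "A \<union> B"]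
    by auto
  have inj: "inj_on ?h (?PA \<times> ?PB)"
  proof (rule inj_onI, clarify)
    fix p q p' q'
    assume p: "p permutes A" "p' permutes A" and q: "q permutes B" "q' permutes B"
      and eq: "p \<circ> q = p' \<circ> q'"
    have "p x = p' x" for x
      using onA[OF q(1), of x p] onA[OF q(2), of x p'] eq p
      by (cases "x \<in> A") (auto simp: permutes_not_in)
    moreover have "q x = q' x" for x
      using onB[OF p(1) q(1), of x] onB[OF p(2) q(2), of x] eq q
      by (cases "x \<in> B") (auto simp: permutes_not_in)
    ultimately show "p = p' \<and> q = q'" by auto
  qed
  \<comment> \<open>If \<open>r\<close> sends some element of \<open>B\<close> into
    \<open>A\<close>, its product contains an entry of the zero block. Otherwise \<open>r\<close>
    maps \<open>B\<close> onto \<open>B\<close> by finiteness, hence \<open>A\<close> onto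
    \<open>A\<close>, and is the composition of its two restrictions.\<close>
  have vanish: "?t r = 0" if r: "r permutes A \<union> B" and not: "r \<notin> ?h ` (?PA \<times> ?PB)" for r
  proof (cases "\<exists>b\<in>B. r b \<in> A")
    case True
    then obtain b where b: "b \<in> B" "r b \<in> A" by blast
    then have "M b (r b) = 0" by (rule zero)
    then have "(\<Prod>i\<in>A \<union> B. M i (r i)) = 0"
      using b fin by (intro prod_zero) auto
    then show ?thesis by simp
  next
    case False
    have img: "r x \<in> A \<union> B \<longleftrightarrow> x \<in> A \<union> B" for x
      using r by (rule permutes_in_image)
    have inj_r: "inj r" using r by (rule permutes_inj)
    have rB: "r ` B = B"
      using False img inj_r fin by (intro endo_inj_surj) (auto intro: inj_on_subset)
    have "r ` A \<subseteq> A"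
    proof
      fix y assume "y \<in> r ` A"
      then obtain a where a: "a \<in> A" "y = r a" by blast
      have "r a \<notin> B"
      proof
        assume "r a \<in> B"
        then obtain b where "b \<in> B" "r a = r b" using rB by auto
        then show False using inj_r a disj by (auto dest: injD)
      qed
      then show "y \<in> A" using a img[of a] by auto
    qed
    then have rA: "r ` A = A"
      using inj_r fin by (intro endo_inj_surj) (auto intro: inj_on_subset)
    define p where "p = restrict_id r A"
    define q where "q = restrict_id r B"
    have "inj_on r A" "inj_on r B" using inj_r by (auto intro: inj_on_subset)
    then have "p permutes A" "q permutes B"
      unfolding p_def q_def using rA rB
      by (auto intro!: permutes_restrict_id simp: bij_betw_def)
    moreover have "r = p \<circ> q"
    proof
      fix x
      show "r x = (p \<circ> q) x"
      proof (cases "x \<in> B")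
        case True
        then have "r x \<in> B" "r x \<notin> A" using rB False by auto
        then show ?thesis using True by (auto simp: p_def q_def restrict_id_def)
      next
        case False
        then show ?thesis using permutes_not_in[OF r, of x]
          by (auto simp: p_def q_def restrict_id_def)
      qed
    qed
    ultimately have "r \<in> ?h ` (?PA \<times> ?PB)" by (auto simp: image_def)
    with not show ?thesis by simp
  qed
  have "fdet (A \<union> B) M = sum ?t (?h ` (?PA \<times> ?PB))"
    unfolding fdet_def
    by (rule sum.mono_neutral_right) (use fin perm vanish in \<open>auto simp: finite_permutations\<close>)
  also have "\<dots> = (\<Sum>x\<in>?PA \<times> ?PB. ?t (?h x))"
    by (subst sum.reindex[OF inj]) simp
  also have "\<dots> = (\<Sum>p\<in>?PA. \<Sum>q\<in>?PB. ?t (p \<circ> q))"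
    by (simp add: sum.cartesian_product case_prod_unfold)
  also have "\<dots> = (\<Sum>p\<in>?PA. \<Sum>q\<in>?PB. (of_int (sign p) * (\<Prod>i\<in>A. M i (p i))) *
        (of_int (sign q) * (\<Prod>i\<in>B. M i (q i))))"
  proof (intro sum.cong refl)
    fix p q assume "p \<in> ?PA" "q \<in> ?PB"
    then have p: "p permutes A" and q: "q permutes B" by auto
    have "sign (p \<circ> q) = sign p * sign q"
      using p q fin by (intro sign_compose) (auto intro: permutation_permutes[THEN iffD2])
    moreover have "(\<Prod>i\<in>A \<union> B. M i ((p \<circ> q) i)) = (\<Prod>i\<in>A. M i (p i)) * (\<Prod>i\<in>B. M i (q i))"
      unfolding prod.union_disjoint[OF fin disj]
      by (intro arg_cong2[where f = "(*)"] prod.cong refl)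
         (use onA[OF q, of _ p] onB[OF p q] in auto)
    ultimately show "?t (p \<circ> q) = (of_int (sign p) * (\<Prod>i\<in>A. M i (p i))) *
        (of_int (sign q) * (\<Prod>i\<in>B. M i (q i)))"
      by (simp add: algebra_simps)
  qed
  also have "\<dots> = fdet A M * fdet B M"
    unfolding fdet_def by (simp add: sum_product)
  finally show ?thesis .
qed

lemma fdet_block_triangular':
  assumes "finite A" "finite B" "A \<inter> B = {}" "\<And>a b. a \<in> A \<Longrightarrow> b \<in> B \<Longrightarrow> M a b = 0"
  shows "fdet (A \<union> B) M = fdet A M * fdet B M"
  using fdet_block_triangular[of B A M] assms by (auto simp: Un_commute Int_commute mult.commute)

lemma fdet_scalar:
  assumes "finite S"
  shows "fdet S (\<lambda>i j. if i = j then k else 0) = k ^ card S"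
  using assms
proof (induction S)
  case (insert a S)
  then have "fdet (S \<union> {a}) (\<lambda>i j. if i = j then k else 0) = k ^ card S * k"
    by (subst fdet_block_triangular) auto
  with insert show ?case by (simp add: mult.commute)
qed simp

lemma fdet_smult:
  assumes "finite S"
  shows "fdet S (\<lambda>i j. k * M i j) = k ^ card S * fdet S M"
  unfolding fdet_def by (simp add: prod.distrib sum_distrib_left mult.left_commute)

text \<open>The matrix consists of one copy of \<open>M\<close> for each element of
  \<open>I\<close>, with zeros between different copies, so the layers split off one at a
  time.\<close>

lemma fdet_block_diagonal:
  assumes "finite I" "finite W"
  shows "fdet (W \<times> I) (\<lambda>x y. if snd x = snd y then M (fst x) (fst y) else 0) = fdet W M ^ card I"
  using assms(1)
proof (induction I)
  case (insert g I)
  let ?P = "\<lambda>x y. if snd x = snd y then M (fst x) (fst y) else 0"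
  have "fdet (W \<times> {g}) ?P = fdet W (\<lambda>i j. ?P (i, g) (j, g))"
    by (rule fdet_reindex) (use assms in \<open>auto simp: bij_betw_def inj_on_def\<close>)
  then have *: "fdet (W \<times> {g}) ?P = fdet W M" by simp
  have "fdet (W \<times> I \<union> W \<times> {g}) ?P = fdet W M ^ card I * fdet W M"
    by (subst fdet_block_triangular) (use insert assms * in auto)
  moreover have "W \<times> insert g I = W \<times> I \<union> W \<times> {g}" by auto
  ultimately show ?case using insert by (simp add: mult.commute)
qed simp

text \<open>
  Cleared of denominators, because the group ring has zero divisors.
\<close>

lemma fdet_schur_complement:
  assumes fin: "finite A" "finite B" and disj: "A \<inter> B = {}"
    and R: "\<And>i j. i \<in> B \<Longrightarrow> j \<in> B \<Longrightarrow> (\<Sum>b\<in>B. P i b * R b j) = (if i = j then k else 0)"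
  shows "fdet (A \<union> B) P * k ^ card A
       = fdet A (\<lambda>a a'. k * P a a' - (\<Sum>b\<in>B. \<Sum>b'\<in>B. P a b * R b b' * P b' a')) * fdet B P"
proof -
  \<comment> \<open>Column elimination as a matrix: \<open>k\<close> times the identity on
    \<open>A\<close>, the identity on \<open>B\<close>, and minus \<open>R\<close> times the lower
    left block of \<open>P\<close> below. Since \<open>R\<close> inverts the block of
    \<open>P\<close> on \<open>B\<close> up to \<open>k\<close>, the product of \<open>P\<close> and
    \<open>Q\<close> has zero lower left block.\<close>
  define Q where "Q i j = (if j \<in> A then if i \<in> A then if i = j then k else 0
      else - (\<Sum>b\<in>B. R i b * P b j) else if i = j then 1 else 0)" for i j
  define PQ where "PQ i j = (\<Sum>l\<in>A \<union> B. P i l * Q l j)" for i j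
  have AB: "b \<notin> A" if "b \<in> B" for b using that disj by auto
  have "fdet (A \<union> B) Q = fdet A Q * fdet B Q"
    using fin disj by (intro fdet_block_triangular') (auto simp: Q_def)
  moreover have "fdet A Q = fdet A (\<lambda>i j. if i = j then k else 0)"
    by (rule fdet_cong) (auto simp: Q_def)
  moreover have "fdet B Q = fdet B (\<lambda>i j. if i = j then 1 else 0)"
    by (rule fdet_cong) (auto simp: Q_def AB)
  ultimately have Q: "fdet (A \<union> B) Q = k ^ card A"
    using fin by (simp add: fdet_scalar)
  have PQA: "PQ i a = P i a * k - (\<Sum>b\<in>B. \<Sum>b'\<in>B. P i b * R b b' * P b' a)" if "a \<in> A" for i a
  proof -
    have "(\<Sum>l\<in>A. P i l * Q l a) = (\<Sum>l\<in>A. if l = a then P i a * k else 0)"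
      by (rule sum.cong) (use that in \<open>auto simp: Q_def\<close>)
    moreover have "(\<Sum>l\<in>B. P i l * Q l a) = - (\<Sum>b\<in>B. \<Sum>b'\<in>B. P i b * R b b' * P b' a)"
      using that AB by (simp add: Q_def sum_negf sum_distrib_left mult.assoc)
    ultimately show ?thesis
      using that fin disj by (simp add: PQ_def sum.union_disjoint)
  qed
  have PQB: "PQ i b = P i b" if "b \<in> B" for i b
  proof -
    have "PQ i b = (\<Sum>l\<in>A \<union> B. if l = b then P i b else 0)"
      unfolding PQ_def by (rule sum.cong) (use that AB in \<open>auto simp: Q_def\<close>)
    then show ?thesis using that fin by simp
  qed
  have "PQ b a = 0" if "b \<in> B" "a \<in> A" for a b
  proof -
    have "(\<Sum>l\<in>B. \<Sum>b'\<in>B. P b l * R l b' * P b' a) = (\<Sum>b'\<in>B. (\<Sum>l\<in>B. P b l * R l b') * P b' a)"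
      unfolding sum_distrib_right by (rule sum.swap)
    also have "\<dots> = (\<Sum>b'\<in>B. if b' = b then k * P b a else 0)"
      by (rule sum.cong) (use that R in auto)
    finally show ?thesis using that fin PQA[OF that(2), of b] by (simp add: mult.commute)
  qed
  then have "fdet (A \<union> B) PQ = fdet A PQ * fdet B PQ"
    using fin disj by (intro fdet_block_triangular) auto
  moreover have "fdet (A \<union> B) PQ = fdet (A \<union> B) P * fdet (A \<union> B) Q"
    unfolding PQ_def using fin by (intro fdet_mult) auto
  moreover have "fdet A PQ = fdet A (\<lambda>a a'. k * P a a' - (\<Sum>b\<in>B. \<Sum>b'\<in>B. P a b * R b b' * P b' a'))"
    by (rule fdet_cong) (simp add: PQA mult.commute)
  moreover have "fdet B PQ = fdet B P"
    by (rule fdet_cong) (simp add: PQB)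
  ultimately show ?thesis using Q by simp
qed

text \<open>
  Multiplying by the unimodular matrix whose last column is \<open>(1, \<dots>, m)\<close> and which otherwise is the
  identity turns the last column into \<open>(0, \<dots>, 0, m + 1)\<close>.
\<close>

lemma fdet_path_matrix:
  "fdet {1..m} (\<lambda>k l. if k = l then 2 else if l = Suc k \<or> k = Suc l then - 1 else 0 :: int) = int m + 1"
proof (induction m)
  case (Suc m)
  let ?T = "\<lambda>k l::nat. if k = l then 2 else if l = Suc k \<or> k = Suc l then - 1 else 0 :: int"
  let ?S = "{1..m} \<union> {Suc m}"
  define U :: "nat \<Rightarrow> nat \<Rightarrow> int" where "U k l = (if l = Suc m then int k else if k = l then 1 else 0)" for k l
  define TU where "TU k l = (\<Sum>j\<in>?S. ?T k j * U j l)" for k l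
  have S: "{1..Suc m} = ?S" by auto
  have "fdet ?S U = fdet {1..m} U * fdet {Suc m} U"
    by (rule fdet_block_triangular) (auto simp: U_def)
  moreover have "fdet {1..m} U = fdet {1..m} (\<lambda>i j. if i = j then 1 else 0)"
    by (rule fdet_cong) (auto simp: U_def)
  ultimately have U: "fdet ?S U = int (Suc m)"
    by (simp add: fdet_scalar U_def)
  \<comment> \<open>Because 2k - (k+1) - (k-1) = 0, only the last row survives, where the neighbour
    \<open>Suc k\<close> is missing. In the first row the missing neighbour 0 would have weight 0
    anyway.\<close>
  have last: "TU k (Suc m) = (if k = Suc m then int m + 2 else 0)" if "k \<in> ?S" for k
  proof -
    have "TU k (Suc m) = (\<Sum>j\<in>?S. (if j = k then 2 * int k else 0)
        - (if j = Suc k then int (Suc k) else 0) - (if j = k - 1 then int (k - 1) else 0))"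
      unfolding TU_def by (rule sum.cong) (use that in \<open>auto simp: U_def\<close>)
    also have "\<dots> = 2 * int k - (if Suc k \<in> ?S then int (Suc k) else 0)
        - (if k - 1 \<in> ?S then int (k - 1) else 0)"
      using that by (simp only: sum_subtractf sum.delta finite_Un finite_atLeastAtMost finite.intros) auto
    also have "\<dots> = (if k = Suc m then int m + 2 else 0)"
      using that by auto
    finally show ?thesis .
  qed
  have other: "TU k l = ?T k l" if "l \<in> {1..m}" for k l
  proof -
    have "TU k l = (\<Sum>j\<in>?S. if j = l then ?T k l else 0)"
      unfolding TU_def by (rule sum.cong) (use that in \<open>auto simp: U_def\<close>)
    then show ?thesis using that by simp
  qed
  have "fdet ?S TU = fdet {1..m} TU * fdet {Suc m} TU"
    by (rule fdet_block_triangular') (auto simp: last)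
  moreover have "fdet {1..m} TU = fdet {1..m} ?T"
    by (rule fdet_cong) (simp add: other)
  moreover have "fdet ?S TU = fdet ?S ?T * fdet ?S U"
    unfolding TU_def by (rule fdet_mult) simp
  ultimately have "fdet ?S ?T * int (Suc m) = (int m + 1) * (int m + 2)"
    using Suc.IH last[of "Suc m"] U by simp
  \<comment> \<open>The determinant of \<open>U\<close> is \<open>Suc m\<close>, its last diagonal
    entry, so the product formula gives the claim multiplied by this nonzero factor.\<close>
  then have "int (Suc m) * fdet ?S ?T = int (Suc m) * (int m + 2)"
    by (simp add: algebra_simps)
  then have "fdet ?S ?T = int m + 2"
    by (simp only: mult_cancel_left) simp
  then show ?case unfolding S by simp
qed simp

section \<open>The order of the cokernel of an integer matrix\<close>

text \<open>Plain functions in place of finitely supported ones keep the elimination free of support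
  conditions; \<open>matrix_image_eq\<close> makes the connection.\<close>

definition in_image :: "'i set \<Rightarrow> ('i \<Rightarrow> 'i \<Rightarrow> int) \<Rightarrow> ('i \<Rightarrow> int) \<Rightarrow> bool" where
  "in_image S M y \<longleftrightarrow> (\<exists>x. \<forall>s\<in>S. y s = (\<Sum>t\<in>S. M s t * x t))"

definition add_column :: "'i \<Rightarrow> 'i \<Rightarrow> int \<Rightarrow> ('i \<Rightarrow> 'i \<Rightarrow> int) \<Rightarrow> 'i \<Rightarrow> 'i \<Rightarrow> int" where
  "add_column j k q M = (\<lambda>i l. if l = j then M i j + q * M i k else M i l)"

lemma fdet_add_column:
  assumes fin: "finite S" and "j \<in> S" "k \<in> S" "j \<noteq> k"
  shows "fdet S (add_column j k q M) = fdet S M"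
proof -
  \<comment> \<open>The column operation is right multiplication by this elementary matrix.
    Splitting off the index \<open>j\<close> shows it to be triangular with unit diagonal.\<close>
  define E where "E i l = (if i = l then 1 else if i = k \<and> l = j then q else 0)" for i l
  have "fdet (S - {j} \<union> {j}) E = fdet (S - {j}) E * fdet {j} E"
    using fin assms by (intro fdet_block_triangular) (auto simp: E_def)
  moreover have "fdet (S - {j}) E = fdet (S - {j}) (\<lambda>i l. if i = l then 1 else 0)"
    by (rule fdet_cong) (auto simp: E_def)
  moreover have "S - {j} \<union> {j} = S" using assms by auto
  ultimately have "fdet S E = 1"
    using fin by (simp add: fdet_scalar E_def)
  moreover have "fdet S (add_column j k q M) = fdet S (\<lambda>i l. \<Sum>t\<in>S. M i t * E t l)"
  proof (rule fdet_cong)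
    fix i l assume "i \<in> S" "l \<in> S"
    have "(\<Sum>t\<in>S. M i t * E t l)
        = (\<Sum>t\<in>S. (if t = l then M i l else 0) + (if t = k then if l = j then q * M i k else 0 else 0))"
      by (rule sum.cong) (use assms in \<open>auto simp: E_def\<close>)
    also have "\<dots> = add_column j k q M i l"
      using assms \<open>l \<in> S\<close> by (simp add: sum.distrib add_column_def)
    finally show "add_column j k q M i l = (\<Sum>t\<in>S. M i t * E t l)" ..
  qed
  ultimately show ?thesis using fdet_mult[OF fin, of M E] by simp
qed

lemma add_column_sum:
  assumes "finite S" "j \<in> S" "k \<in> S" "j \<noteq> k"
  shows "(\<Sum>t\<in>S. add_column j k q M s t * x t) = (\<Sum>t\<in>S. M s t * (x(k := x k + q * x j)) t)"
proof -
  have "(\<Sum>t\<in>S. add_column j k q M s t * x t)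
      = (\<Sum>t\<in>S. M s t * x t + (if t = j then q * M s k * x j else 0))"
    by (rule sum.cong) (auto simp: add_column_def algebra_simps)
  also have "\<dots> = (\<Sum>t\<in>S. M s t * x t + (if t = k then q * M s k * x j else 0))"
    using assms by (simp add: sum.distrib)
  also have "\<dots> = (\<Sum>t\<in>S. M s t * (x(k := x k + q * x j)) t)"
    by (rule sum.cong) (auto simp: algebra_simps)
  finally show ?thesis .
qed

text \<open>A column operation amounts to a substitution in the coordinates of the preimage, and the
  substitution with \<open>- q\<close> undoes it.\<close>

lemma in_image_add_column:
  assumes "finite S" "j \<in> S" "k \<in> S" "j \<noteq> k"
  shows "in_image S (add_column j k q M) y \<longleftrightarrow> in_image S M y"
proof
  assume "in_image S (add_column j k q M) y"
  then show "in_image S M y"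
    unfolding in_image_def add_column_sum[OF assms] by blast
next
  assume "in_image S M y"
  then obtain x where x: "\<forall>s\<in>S. y s = (\<Sum>t\<in>S. M s t * x t)"
    unfolding in_image_def by blast
  let ?x = "x(k := x k - q * x j)"
  have eq: "?x(k := ?x k + q * ?x j) = x" using assms by auto
  then show "in_image S (add_column j k q M) y"
    unfolding in_image_def add_column_sum[OF assms]
    using x by (intro exI[of _ ?x]) (simp only: eq)
qed

text \<open>Euclid's algorithm on row \<open>a\<close> by column operations, which preserve both the
  determinant and the image; the pivot entry ends up carrying the whole row.\<close>

lemma clear_row:
  assumes fin: "finite S" and a: "a \<notin> S"
  obtains M' where "\<And>j. j \<in> S \<Longrightarrow> M' a j = 0"
    "fdet (insert a S) M' = fdet (insert a S) M"
    "\<And>y. in_image (insert a S) M' y \<longleftrightarrow> in_image (insert a S) M y"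
proof -
  \<comment> \<open>Entries off the pivot count twice, so that moving an entry into a zero pivot
    also lowers the measure.\<close>
  define \<mu> where "\<mu> M = nat (\<bar>M a a\<bar> + 2 * (\<Sum>j\<in>S. \<bar>M a j\<bar>))" for M :: "'a \<Rightarrow> 'a \<Rightarrow> int"
  have \<mu>: "\<mu> M = nat (\<bar>M a a\<bar> + (2 * \<bar>M a j\<bar> + 2 * (\<Sum>i\<in>S - {j}. \<bar>M a i\<bar>)))" if "j \<in> S" for M j
    using that fin by (simp add: \<mu>_def sum.remove)
  have "\<exists>M'. (\<forall>j\<in>S. M' a j = 0) \<and> fdet (insert a S) M' = fdet (insert a S) M
      \<and> (\<forall>y. in_image (insert a S) M' y \<longleftrightarrow> in_image (insert a S) M y)"
  proof (induction "\<mu> M" arbitrary: M rule: less_induct)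
    case less
    have step: ?case if "\<mu> (add_column j k q M) < \<mu> M" "j \<in> insert a S" "k \<in> insert a S" "j \<noteq> k" for j k q
      using less[OF that(1)] that fin by (simp add: fdet_add_column in_image_add_column)
    show ?case
    proof (cases "\<forall>j\<in>S. M a j = 0")
      case False
      then obtain j where j: "j \<in> S" "M a j \<noteq> 0" by blast
      then have ja: "j \<noteq> a" using a by auto
      \<comment> \<open>With this sign, adding \<open>s\<close> times the entry of smaller absolute
        value brings the larger one closer to zero.\<close>
      define s where "s = - (sgn (M a a) * sgn (M a j))"
      have pos: "0 \<le> (\<Sum>i\<in>S - {j}. \<bar>M a i\<bar>)" by (rule sum_nonneg) simp
      consider "M a a = 0" | "M a a \<noteq> 0" "\<bar>M a j\<bar> \<le> \<bar>M a a\<bar>" | "M a a \<noteq> 0" "\<bar>M a a\<bar> < \<bar>M a j\<bar>"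
        by linarith
      then show ?thesis
      proof cases
        case 1
        \<comment> \<open>With x = \<open>M a j\<close>, the entries at \<open>a\<close> and
          \<open>j\<close> go from (0, x) to (x, x) and then to (x, 0).\<close>
        define N where "N = add_column a j 1 M"
        define N' where "N' = add_column j a (- 1) N"
        have "(\<Sum>i\<in>S - {j}. \<bar>N' a i\<bar>) = (\<Sum>i\<in>S - {j}. \<bar>M a i\<bar>)"
          by (rule sum.cong) (use a in \<open>auto simp: N'_def N_def add_column_def\<close>)
        moreover have "N' a a = M a j" "N' a j = 0"
          using 1 ja by (auto simp: N'_def N_def add_column_def)
        ultimately have "\<mu> N' < \<mu> M"
          using 1 by (simp add: \<mu>[OF j(1)], use pos j(2) in linarith)
        from less[OF this] show ?thesis
          using j ja fin by (simp add: N'_def N_def fdet_add_column in_image_add_column)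
      next
        case 2
        have "(\<Sum>i\<in>S - {j}. \<bar>add_column a j s M a i\<bar>) = (\<Sum>i\<in>S - {j}. \<bar>M a i\<bar>)"
          by (rule sum.cong) (use a in \<open>auto simp: add_column_def\<close>)
        moreover have "\<bar>add_column a j s M a a\<bar> < \<bar>M a a\<bar>" "add_column a j s M a j = M a j"
          using 2 j ja by (auto simp: add_column_def s_def sgn_if)
        ultimately have "\<mu> (add_column a j s M) < \<mu> M"
          by (simp add: \<mu>[OF j(1)], use pos 2 in linarith)
        then show ?thesis using j ja by (intro step[of a j s]) auto
      next
        case 3
        have "(\<Sum>i\<in>S - {j}. \<bar>add_column j a s M a i\<bar>) = (\<Sum>i\<in>S - {j}. \<bar>M a i\<bar>)"
          by (rule sum.cong) (use a in \<open>auto simp: add_column_def\<close>)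
        moreover have "\<bar>add_column j a s M a j\<bar> < \<bar>M a j\<bar>" "add_column j a s M a a = M a a"
          using 3 j ja by (auto simp: add_column_def s_def sgn_if)
        ultimately have "\<mu> (add_column j a s M) < \<mu> M"
          by (simp add: \<mu>[OF j(1)], use pos 3 in linarith)
        then show ?thesis using j ja by (intro step[of j a s]) auto
      qed
    qed auto
  qed
  then show thesis using that by blast
qed

text \<open>
  Once row \<open>a\<close> is \<open>(g, 0, \<dots>, 0)\<close>, a vector is reduced by taking the entry at \<open>a\<close> modulo \<open>g\<close> and then
  the remaining entries modulo the image of the complementary block.
\<close>

lemma image_transversal:
  assumes "finite S" "fdet S M \<noteq> 0"
  shows "\<exists>T. finite T \<and> card T = nat \<bar>fdet S M\<bar> \<and> (\<forall>t\<in>T. \<forall>i. i \<notin> S \<longrightarrow> t i = 0)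
     \<and> (\<forall>y. \<exists>!t. t \<in> T \<and> in_image S M (\<lambda>i. y i - t i))"
  using assms
proof (induction S arbitrary: M)
  case empty
  then show ?case by (intro exI[of _ "{\<lambda>_. 0}"]) (auto simp: in_image_def)
next
  case (insert a S)
  note fin = \<open>finite S\<close> and a = \<open>a \<notin> S\<close>
  obtain N where row: "\<And>j. j \<in> S \<Longrightarrow> N a j = 0"
    and detN: "fdet (insert a S) N = fdet (insert a S) M"
    and imN: "\<And>y. in_image (insert a S) N y \<longleftrightarrow> in_image (insert a S) M y"
    using clear_row[OF fin a, of M] by blast
  define g where "g = N a a"
  have "fdet (S \<union> {a}) N = fdet S N * fdet {a} N"
    using fin a row by (intro fdet_block_triangular) auto
  then have det: "fdet (insert a S) M = g * fdet S N"
    using detN by (simp add: g_def mult.commute)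
  then have g0: "g \<noteq> 0" and "fdet S N \<noteq> 0" using insert.prems by auto
  from insert.IH[OF this(2)] obtain T where T: "finite T" "card T = nat \<bar>fdet S N\<bar>"
    "\<forall>t\<in>T. \<forall>i. i \<notin> S \<longrightarrow> t i = 0"
    "\<forall>y. \<exists>!t. t \<in> T \<and> in_image S N (\<lambda>i. y i - t i)"
    by (elim exE conjE) (rule that)
  have sum_insert: "(\<Sum>t\<in>insert a S. N s t * x t) = N s a * x a + (\<Sum>t\<in>S. N s t * x t)" for s x
    using fin a by simp
  have sum_a: "(\<Sum>t\<in>insert a S. N a t * x t) = g * x a" for x
    using fin a row by (simp add: g_def)
  \<comment> \<open>Row \<open>a\<close> of \<open>N\<close> is zero off the pivot, so the entry
    \<open>y a\<close> alone fixes the coefficient \<open>q\<close> of column \<open>a\<close>; what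
    remains is a question about the block on \<open>S\<close>.\<close>
  have block: "in_image (insert a S) M y \<longleftrightarrow> (\<exists>q. y a = g * q \<and> in_image S N (\<lambda>i. y i - N i a * q))" for y
  proof
    assume "in_image (insert a S) M y"
    then have "in_image (insert a S) N y" by (simp only: imN)
    then obtain x where x: "\<forall>s\<in>insert a S. y s = (\<Sum>t\<in>insert a S. N s t * x t)"
      unfolding in_image_def by blast
    have "y a = g * x a" using x sum_a by auto
    moreover have "in_image S N (\<lambda>i. y i - N i a * x a)"
      unfolding in_image_def using x by (intro exI[of _ x]) (simp only: sum_insert, simp)
    ultimately show "\<exists>q. y a = g * q \<and> in_image S N (\<lambda>i. y i - N i a * q)" by blast
  next
    assume "\<exists>q. y a = g * q \<and> in_image S N (\<lambda>i. y i - N i a * q)"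
    then obtain q x where q: "y a = g * q" and x: "\<forall>s\<in>S. y s - N s a * q = (\<Sum>t\<in>S. N s t * x t)"
      unfolding in_image_def by blast
    have "(\<Sum>t\<in>S. N s t * (x(a := q)) t) = (\<Sum>t\<in>S. N s t * x t)" for s
      by (rule sum.cong) (use a in auto)
    then have "\<forall>s\<in>insert a S. y s = (\<Sum>t\<in>insert a S. N s t * (x(a := q)) t)"
      using q x sum_a[of "x(a := q)"] by (auto simp: sum_insert simp del: fun_upd_apply) 
         (auto simp: algebra_simps)
    then have "in_image (insert a S) N y" unfolding in_image_def by blast
    then show "in_image (insert a S) M y" by (simp only: imN)
  qed
  \<comment> \<open>A representative combines a residue at \<open>a\<close> with a representative
    for the block. The latter vanishes at \<open>a\<close>, which makes \<open>h\<close> injective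
    and the cardinalities multiply.\<close>
  define h where "h = (\<lambda>(r, t). t(a := r) :: 'a \<Rightarrow> int)"
  define T' where "T' = h ` ({0..<\<bar>g\<bar>} \<times> T)"
  have "inj_on h ({0..<\<bar>g\<bar>} \<times> T)"
  proof (rule inj_onI, clarify)
    fix r t r' t' assume t: "t \<in> T" "t' \<in> T" and eq: "h (r, t) = h (r', t')"
    have "r = r'" using fun_cong[OF eq, of a] by (simp add: h_def)
    moreover have "t a = 0" "t' a = 0" using T(3) t a by blast+
    then have "t i = t' i" for i
      using fun_cong[OF eq, of i]
      by (cases "i = a") (auto simp: h_def)
    ultimately show "r = r' \<and> t = t'" by auto
  qed
  then have "card T' = card ({0..<\<bar>g\<bar>} \<times> T)"
    unfolding T'_def by (rule card_image)
  then have card: "card T' = nat \<bar>fdet (insert a S) M\<bar>"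
    using T(2) by (simp add: det abs_mult nat_mult_distrib card_cartesian_product)
  have supp: "\<forall>t\<in>T'. \<forall>i. i \<notin> insert a S \<longrightarrow> t i = 0"
    using T(3) by (auto simp: T'_def h_def)
  have upd: "in_image S N (\<lambda>i. y i - (t(a := r)) i - z i) \<longleftrightarrow> in_image S N (\<lambda>i. y i - z i - t i)" for y t r z
    unfolding in_image_def using a by (intro ex_cong1 ball_cong refl) (auto simp: algebra_simps)
  have "\<exists>!t. t \<in> T' \<and> in_image (insert a S) M (\<lambda>i. y i - t i)" for y
  proof -
    \<comment> \<open>The modulus is \<open>\<bar>g\<bar>\<close> because the pivot may be
      negative.\<close>
    define r where "r = y a mod \<bar>g\<bar>"
    have r: "r \<in> {0..<\<bar>g\<bar>}" using g0 by (simp add: r_def)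
    have "g dvd y a - r"
      using minus_mod_eq_mult_div[of "y a" "\<bar>g\<bar>"] by (simp add: r_def)
    then obtain q where q: "y a - r = g * q" by blast
    obtain t where t: "t \<in> T" "in_image S N (\<lambda>i. (y i - N i a * q) - t i)"
      and uniq: "\<And>t'. t' \<in> T \<Longrightarrow> in_image S N (\<lambda>i. (y i - N i a * q) - t' i) \<Longrightarrow> t' = t"
      using T(4)[rule_format, of "\<lambda>i. y i - N i a * q"] by blast
    show ?thesis
    proof (rule ex1I[of _ "t(a := r)"], intro conjI)
      show "t(a := r) \<in> T'" using r t(1) by (force simp: T'_def h_def)
      show "in_image (insert a S) M (\<lambda>i. y i - (t(a := r)) i)"
        unfolding block upd using t(2) q by auto
    next
      fix u assume "u \<in> T' \<and> in_image (insert a S) M (\<lambda>i. y i - u i)"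
      then obtain r' t' where u: "u = t'(a := r')" and r': "r' \<in> {0..<\<bar>g\<bar>}" and t': "t' \<in> T"
        and im: "in_image (insert a S) M (\<lambda>i. y i - (t'(a := r')) i)"
        by (auto simp: T'_def h_def)
      from im obtain q' where q': "y a - r' = g * q'"
        and im': "in_image S N (\<lambda>i. y i - N i a * q' - t' i)"
        unfolding block upd by auto
      have "y a mod \<bar>g\<bar> = r' mod \<bar>g\<bar>"
        using q' by (metis abs_dvd_iff dvd_triv_left mod_eq_dvd_iff)
      then have "r' = r" using r' by (simp add: r_def)
      then have "q' = q" using q q' g0 by simp
      then have "t' = t" using uniq[OF t'] im' by simp
      with u \<open>r' = r\<close> show "u = t(a := r)" by simp
    qed
  qed
  moreover have "finite T'" using T(1) by (simp add: T'_def)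
  ultimately show ?case using card supp by (intro exI[of _ T']) auto
qed

section \<open>The image as a subgroup of the free abelian group, and its cosets\<close>

lemma matrix_image_eq:
  "matrix_image S M = {y. Poly_Mapping.keys y \<subseteq> S \<and> in_image S M (Poly_Mapping.lookup y)}"
  if "finite S"
proof -
  have "in_image S M (Poly_Mapping.lookup y) \<longleftrightarrow> (\<exists>x. Poly_Mapping.keys x \<subseteq> S \<and>
      (\<forall>s\<in>S. Poly_Mapping.lookup y s = (\<Sum>t\<in>S. M s t * Poly_Mapping.lookup x t)))" for y
  proof
    assume "in_image S M (Poly_Mapping.lookup y)"
    then obtain x where x: "\<forall>s\<in>S. Poly_Mapping.lookup y s = (\<Sum>t\<in>S. M s t * x t)"
      unfolding in_image_def by blast
    \<comment> \<open>Cutting the coordinates off outside \<open>S\<close> gives finite support and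
      leaves the sums over \<open>S\<close> unchanged.\<close>
    define x' where "x' = Abs_poly_mapping (\<lambda>i. if i \<in> S then x i else 0)"
    have x': "Poly_Mapping.lookup x' = (\<lambda>i. if i \<in> S then x i else 0)"
      unfolding x'_def by (rule lookup_Abs_poly_mapping) (use that in auto)
    then have "Poly_Mapping.keys x' \<subseteq> S" by (auto simp: in_keys_iff split: if_splits)
    with x x' show "\<exists>x. Poly_Mapping.keys x \<subseteq> S \<and>
      (\<forall>s\<in>S. Poly_Mapping.lookup y s = (\<Sum>t\<in>S. M s t * Poly_Mapping.lookup x t))"
      by (intro exI[of _ x']) simp
  qed (auto simp: in_image_def)
  then show ?thesis
    unfolding matrix_image_def Bex_def carrier_free_Abelian_group_iff by simp
qed

lemma in_image_diff:
  assumes "in_image S M x" "in_image S M y"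
  shows "in_image S M (\<lambda>i. x i - y i)"
proof -
  obtain u w where "\<forall>s\<in>S. x s = (\<Sum>t\<in>S. M s t * u t)" "\<forall>s\<in>S. y s = (\<Sum>t\<in>S. M s t * w t)"
    using assms unfolding in_image_def by blast
  then show ?thesis
    unfolding in_image_def
    by (intro exI[of _ "\<lambda>i. u i - w i"]) (simp add: right_diff_distrib sum_subtractf)
qed

lemma subgroup_matrix_image:
  assumes "finite S"
  shows "subgroup (matrix_image S M) (free_Abelian_group S)"
proof -
  have zero: "in_image S M (\<lambda>_. 0)"
    unfolding in_image_def by (intro exI[of _ "\<lambda>_. 0"]) simp
  have neg: "in_image S M (\<lambda>i. - y i)" if "in_image S M y" for y
    using in_image_diff[OF zero that] by simp
  have add: "in_image S M (\<lambda>i. x i + y i)" if "in_image S M x" "in_image S M y" for x y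
    using in_image_diff[OF that(1) neg[OF that(2)]] by simp
  show ?thesis
  proof (rule group.subgroupI)
    show "group (free_Abelian_group S)" by simp
    show "matrix_image S M \<subseteq> carrier (free_Abelian_group S)"
      by (auto simp: matrix_image_def)
    show "matrix_image S M \<noteq> {}"
    proof -
      have "0 \<in> matrix_image S M"
        using zero by (simp add: matrix_image_eq[OF assms] in_image_def)
      then show ?thesis by blast
    qed
    show "inv\<^bsub>free_Abelian_group S\<^esub> x \<in> matrix_image S M" if "x \<in> matrix_image S M" for x
    proof -
      have "Poly_Mapping.lookup (- x) = (\<lambda>i. - Poly_Mapping.lookup x i)" by (rule ext) simp
      then show ?thesis using that neg by (auto simp: matrix_image_eq[OF assms])
    qed
    show "x \<otimes>\<^bsub>free_Abelian_group S\<^esub> y \<in> matrix_image S M"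
      if "x \<in> matrix_image S M" "y \<in> matrix_image S M" for x y
    proof -
      have "Poly_Mapping.lookup (x + y) = (\<lambda>i. Poly_Mapping.lookup x i + Poly_Mapping.lookup y i)"
        by (rule ext) (simp add: lookup_add)
      then show ?thesis
        using that add keys_add[of x y]
        unfolding matrix_image_eq[OF assms] mem_Collect_eq mult_free_Abelian_group by auto
    qed
  qed
qed

text \<open>The transversal \<open>T\<close> has as many elements as the absolute value of the
  determinant and meets every coset of the image exactly once. Its members vanish outside
  \<open>S\<close>, so they are elements of the free abelian group.\<close>

theorem order_cokernel:
  assumes fin: "finite S" and det: "fdet S M \<noteq> 0"
  shows "int (Coset.order (cokernel S M)) = \<bar>fdet S M\<bar>"
proof -
  let ?F = "free_Abelian_group S" and ?H = "matrix_image S M"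
  interpret F: group ?F by simp
  have sub: "subgroup ?H ?F" using fin by (rule subgroup_matrix_image)
  obtain T where T: "finite T" "card T = nat \<bar>fdet S M\<bar>"
    and supp': "\<forall>t\<in>T. \<forall>i. i \<notin> S \<longrightarrow> t i = 0"
    and trans: "\<forall>y. \<exists>!t. t \<in> T \<and> in_image S M (\<lambda>i. y i - t i)"
    using image_transversal[OF assms] by (elim exE conjE) (rule that)
  have supp: "t i = 0" if "t \<in> T" "i \<notin> S" for t i using supp' that by blast
  note trans = trans[rule_format]
  have lookup_T: "Poly_Mapping.lookup (Abs_poly_mapping t) = t" if "t \<in> T" for t
    using supp[OF that] fin by (intro lookup_Abs_poly_mapping) (auto intro: finite_subset[of _ S])
  have keys_T: "Poly_Mapping.keys (Abs_poly_mapping t) \<subseteq> S" if "t \<in> T" for t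
    using supp[OF that] lookup_T[OF that] by (metis in_keys_iff subsetI)
  have diff: "x - y \<in> ?H \<longleftrightarrow> in_image S M (\<lambda>i. Poly_Mapping.lookup x i - Poly_Mapping.lookup y i)"
    if "Poly_Mapping.keys x \<subseteq> S" "Poly_Mapping.keys y \<subseteq> S" for x y
  proof -
    have "Poly_Mapping.lookup (x - y) = (\<lambda>i. Poly_Mapping.lookup x i - Poly_Mapping.lookup y i)"
      by (rule ext) (simp add: lookup_minus)
    then show ?thesis
      using that keys_diff[of x y] unfolding matrix_image_eq[OF fin] mem_Collect_eq by auto
  qed
  have coset: "x \<in> ?H #>\<^bsub>?F\<^esub> y \<longleftrightarrow> x - y \<in> ?H" for x y
  proof
    assume "x \<in> ?H #>\<^bsub>?F\<^esub> y"
    then show "x - y \<in> ?H" by (auto simp: r_coset_def)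
  next
    assume "x - y \<in> ?H"
    then show "x \<in> ?H #>\<^bsub>?F\<^esub> y" by (force simp: r_coset_def)
  qed
  have coset_eq: "?H #>\<^bsub>?F\<^esub> x = ?H #>\<^bsub>?F\<^esub> y \<longleftrightarrow> x - y \<in> ?H"
    if "Poly_Mapping.keys x \<subseteq> S" "Poly_Mapping.keys y \<subseteq> S" for x y
    using F.repr_independence[OF _ _ sub, of x y] F.rcos_self[OF _ sub, of x] that coset by auto
  let ?f = "\<lambda>t. ?H #>\<^bsub>?F\<^esub> Abs_poly_mapping t"
  have coset_T: "?H #>\<^bsub>?F\<^esub> y = ?f t \<longleftrightarrow> in_image S M (\<lambda>i. Poly_Mapping.lookup y i - t i)"
    if "Poly_Mapping.keys y \<subseteq> S" "t \<in> T" for y t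
    using coset_eq[OF that(1) keys_T[OF that(2)]] diff[OF that(1) keys_T[OF that(2)]]
    by (simp only: lookup_T[OF that(2)])
  have "bij_betw ?f T (carrier (cokernel S M))"
  proof (rule bij_betw_imageI)
    show "inj_on ?f T"
    proof (rule inj_onI)
      fix t u assume tu: "t \<in> T" "u \<in> T" "?f t = ?f u"
      then have "in_image S M (\<lambda>i. t i - u i)"
        using coset_T[OF keys_T[OF tu(1)] tu(2)] by (simp only: lookup_T)
      moreover have "in_image S M (\<lambda>i. t i - t i)"
        unfolding in_image_def by (intro exI[of _ "\<lambda>_. 0"]) simp
      ultimately show "t = u" using trans[of t] tu by blast
    qed
    show "?f ` T = carrier (cokernel S M)"
    proof
      show "?f ` T \<subseteq> carrier (cokernel S M)"
        using keys_T F.rcosetsI[OF subgroup.subset[OF sub]]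
        by (auto simp: cokernel_def FactGroup_def)
      show "carrier (cokernel S M) \<subseteq> ?f ` T"
      proof
        fix C assume "C \<in> carrier (cokernel S M)"
        then obtain y where y: "Poly_Mapping.keys y \<subseteq> S" "C = ?H #>\<^bsub>?F\<^esub> y"
          by (auto simp: cokernel_def FactGroup_def RCOSETS_def)
        obtain t where t: "t \<in> T" "in_image S M (\<lambda>i. Poly_Mapping.lookup y i - t i)"
          using trans by blast
        then have "C = ?f t"
          using y coset_T by (simp only:)
        with t show "C \<in> ?f ` T" by blast
      qed
    qed
  qed
  then have "card T = Coset.order (cokernel S M)"
    unfolding Coset.order_def by (rule bij_betw_same_card)
  with T(2) show ?thesis by simp
qed

section \<open>Reduced Laplacians\<close>

text \<open>
  Writing a vector that vanishes at \<open>r'\<close> as one that vanishes at \<open>r\<close> plus a constant is a unimodular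
  change of coordinates, and it turns one reduced matrix into the other.
\<close>

lemma fdet_delete_index:
  assumes fin: "finite V" and r: "r \<in> V" "r' \<in> V"
    and row: "\<And>i. i \<in> V \<Longrightarrow> (\<Sum>j\<in>V. L i j) = 0"
    and col: "\<And>j. j \<in> V \<Longrightarrow> (\<Sum>i\<in>V. L i j) = 0"
  shows "fdet (V - {r}) L = fdet (V - {r'}) L"
proof (cases "r = r'")
  case False
  define S where "S = V - {r}"
  define \<sigma> where "\<sigma> = Transposition.transpose r r'"
  \<comment> \<open>Column \<open>r'\<close> of \<open>u\<close> is constantly -1: as rows of
    \<open>L\<close> sum to zero, minus the sum of the columns over \<open>S\<close> is the deleted
    column \<open>r\<close>. Columns of \<open>L\<close> are treated in the same way from the left,
    so the determinant -1 of \<open>u\<close> enters squared.\<close>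
  define u where "u k j = (if j = r' then - 1 else if k = j then 1 else 0 :: 'b)" for k j
  have fS: "finite S" "r' \<in> S" and V: "V = insert r S" "r \<notin> S"
    using fin r False by (auto simp: S_def)
  have \<sigma>: "\<sigma> j = (if j = r' then r else j)" if "j \<in> S" for j
    using that V by (auto simp: \<sigma>_def Transposition.transpose_def)
  have "bij_betw \<sigma> S (V - {r'})"
  proof (rule bij_betw_imageI)
    show "inj_on \<sigma> S" unfolding \<sigma>_def by (auto intro: inj_on_subset[OF inj_transpose])
    have "\<sigma> ` S = insert r (S - {r'})"
      using fS(2) V(2) \<sigma> by (auto simp: image_iff split: if_splits)
    then show "\<sigma> ` S = V - {r'}" using V False by auto
  qed
  then have "fdet (V - {r'}) L = fdet S (\<lambda>i j. L (\<sigma> i) (\<sigma> j))"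
    using fS(1) by (rule fdet_reindex)
  also have "\<dots> = fdet S (\<lambda>i j. \<Sum>k\<in>S. u k i * (\<Sum>l\<in>S. L k l * u l j))"
  proof (rule fdet_cong)
    fix i j assume ij: "i \<in> S" "j \<in> S"
    have "(\<Sum>l\<in>S. L k l * u l j) = L k (\<sigma> j)" if "k \<in> V" for k
    proof (cases "j = r'")
      case True
      then show ?thesis using row[OF that] fS V ij
        by (simp add: u_def \<sigma> sum_negf neg_eq_iff_add_eq_0 add.commute)
    next
      case False
      then have "(\<Sum>l\<in>S. L k l * u l j) = (\<Sum>l\<in>S. if l = j then L k l else 0)"
        by (intro sum.cong) (auto simp: u_def)
      then show ?thesis using False fS ij by (simp add: \<sigma>)
    qed
    then have "(\<Sum>k\<in>S. u k i * (\<Sum>l\<in>S. L k l * u l j)) = (\<Sum>k\<in>S. u k i * L k (\<sigma> j))"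
      by (simp add: V(1))
    also have "\<dots> = L (\<sigma> i) (\<sigma> j)"
    proof (cases "i = r'")
      case True
      have "\<sigma> j \<in> V" using ij \<sigma> V fS by auto
      then show ?thesis using True col[of "\<sigma> j"] fS V ij
        by (simp add: u_def \<sigma>[OF fS(2)] sum_negf neg_eq_iff_add_eq_0 add.commute)
    next
      case False
      then have "(\<Sum>k\<in>S. u k i * L k (\<sigma> j)) = (\<Sum>k\<in>S. if k = i then L k (\<sigma> j) else 0)"
        by (intro sum.cong) (auto simp: u_def)
      then show ?thesis using False fS ij by (simp add: \<sigma>[OF ij(1)])
    qed
    finally show "L (\<sigma> i) (\<sigma> j) = (\<Sum>k\<in>S. u k i * (\<Sum>l\<in>S. L k l * u l j))" ..
  qed
  also have "\<dots> = fdet S (\<lambda>i k. u k i) * (fdet S L * fdet S u)"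
    by (simp add: fdet_mult[OF fS(1)])
  also have "\<dots> = fdet S L * (fdet S u * fdet S u)"
    by (simp add: fdet_transpose[OF fS(1), of u])
  also have "fdet S u = - 1"
  proof -
    have "fdet (S - {r'} \<union> {r'}) u = fdet (S - {r'}) u * fdet {r'} u"
      using fS by (intro fdet_block_triangular) (auto simp: u_def)
    moreover have "fdet (S - {r'}) u = fdet (S - {r'}) (\<lambda>i j. if i = j then 1 else 0)"
      by (rule fdet_cong) (auto simp: u_def)
    moreover have "S - {r'} \<union> {r'} = S" using fS by auto
    ultimately show ?thesis using fS by (simp add: fdet_scalar u_def)
  qed
  finally show ?thesis by (simp add: S_def)
qed simp

section \<open>Laplacians of connected graphs\<close>

lemma out_degree_with_proj: "out_degree (with_proj X) u = card {w. (u, w) \<in> parcs X}"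
proof -
  have "out_arcs (with_proj X) u = Pair u ` {w. (u, w) \<in> parcs X}"
    by (auto simp: out_arcs_def)
  then show ?thesis
    unfolding out_degree_def by (simp add: card_image inj_on_def)
qed

context
  fixes X :: "'a pair_pre_digraph"
  assumes X: "pair_graph X"
begin

interpretation pair_graph X by (rule X)

lemma arc_sym: "(u, w) \<in> parcs X \<longleftrightarrow> (w, u) \<in> parcs X"
  using pair_sym_arcs by (auto simp: symmetric_def sym_def)

lemma laplacian_sym: "laplacian X u w = laplacian X w u"
  by (auto simp: laplacian_def degree_matrix_def adjacency_matrix_def arc_sym)

lemma laplacian_row_sum:
  assumes "u \<in> pverts X"
  shows "(\<Sum>w\<in>pverts X. laplacian X u w) = 0"
proof -
  have "{w. (u, w) \<in> parcs X} = {w \<in> pverts X. (u, w) \<in> parcs X}"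
    using in_arcsD2 by auto
  then have "(\<Sum>w\<in>pverts X. adjacency_matrix X u w) = int (out_degree (with_proj X) u)"
    using pair_finite_verts
    by (simp add: adjacency_matrix_def out_degree_with_proj sum.inter_filter[symmetric])
  then show ?thesis
    using assms pair_finite_verts by (simp add: laplacian_def sum_subtractf degree_matrix_def)
qed

lemma laplacian_col_sum:
  assumes "w \<in> pverts X"
  shows "(\<Sum>u\<in>pverts X. laplacian X u w) = 0"
  using laplacian_row_sum[OF assms] by (simp add: laplacian_sym[of _ w])

text \<open>Connectedness speaks of the symmetrised arc set, which here is the arc set itself since
  every arc has its opposite; a property passed along arcs therefore spreads to all
  vertices.\<close>

lemma connected_induct:
  assumes conn: "Digraph_Component.connected (with_proj X)"
    and u: "u \<in> pverts X" "P u" and w: "w \<in> pverts X"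
    and step: "\<And>x y. (x, y) \<in> parcs X \<Longrightarrow> P x \<Longrightarrow> P y"
  shows "P w"
proof -
  have "(u, w) \<in> rtrancl_on (pverts X) (parcs (mk_symmetric (with_proj X)))"
    using conn u w by (auto simp: Digraph_Component.connected_def strongly_connected_def
        reachable_def mk_symmetric_def)
  then show ?thesis
  proof (induction rule: rtrancl_on_induct)
    case (step x y)
    then have "(x, y) \<in> parcs X"
      using arc_sym by (auto simp: mk_symmetric_def)
    with step assms(5) show ?case by blast
  qed (rule u)
qed

text \<open>
  By the maximum principle, a vector in the kernel takes its maximum at all neighbours of a point
  where it takes it.
\<close>

lemma laplacian_kernel_constant:
  assumes conn: "Digraph_Component.connected (with_proj X)"
    and ker: "\<And>u. u \<in> pverts X \<Longrightarrow> (\<Sum>w\<in>pverts X. laplacian X u w * x w) = 0"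
    and uw: "u \<in> pverts X" "w \<in> pverts X"
  shows "x u = x w"
proof -
  let ?V = "pverts X"
  note fin = pair_finite_verts
  define m where "m = Max (x ` ?V)"
  have le: "x u \<le> m" if "u \<in> ?V" for u using that fin by (simp add: m_def)
  have "m \<in> x ` ?V" unfolding m_def using fin uw by (intro Max_in) auto
  then obtain p where p: "p \<in> ?V" "x p = m" by auto
  have step: "x z = m" if yz: "(y, z) \<in> parcs X" and y: "x y = m" for y z
  proof -
    have V: "y \<in> ?V" "z \<in> ?V" using yz in_arcsD1 in_arcsD2 by auto
    \<comment> \<open>The kernel equation at a maximal point \<open>y\<close>, rewritten as a
      vanishing sum of the nonnegative differences \<open>m - x w\<close> over the neighbours of
      \<open>y\<close>.\<close>
    have "(\<Sum>w\<in>?V. adjacency_matrix X y w * (m - x w))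
        = (\<Sum>w\<in>?V. laplacian X y w * x w - laplacian X y w * m)"
      using y by (intro sum.cong) (auto simp: laplacian_def degree_matrix_def algebra_simps)
    also have "\<dots> = 0"
      using ker[OF V(1)] laplacian_row_sum[OF V(1)]
      by (simp add: sum_subtractf sum_distrib_right[symmetric])
    finally have "\<forall>w\<in>?V. adjacency_matrix X y w * (m - x w) = 0"
      using fin le by (subst (asm) sum_nonneg_eq_0_iff) (auto simp: adjacency_matrix_def)
    then show ?thesis using yz V by (auto simp: adjacency_matrix_def)
  qed
  have "x z = m" if "z \<in> ?V" for z
    by (rule connected_induct[where P = "\<lambda>z. x z = m", OF conn p that]) (rule step)
  then show ?thesis using uw by simp
qed

text \<open>A kernel vector of the reduced matrix, extended by 0 at \<open>r\<close>, is killed by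
  the full Laplacian: the equation in row \<open>r\<close> follows from the others because columns
  sum to zero. The extension is then constant, hence equal to its value 0 at
  \<open>r\<close>.\<close>

lemma fdet_reduced_laplacian_nonzero:
  assumes conn: "Digraph_Component.connected (with_proj X)" and r: "r \<in> pverts X"
  shows "fdet (pverts X - {r}) (laplacian X) \<noteq> 0"
proof
  let ?V = "pverts X"
  note fin = pair_finite_verts
  assume "fdet (?V - {r}) (laplacian X) = 0"
  then obtain w i where i: "i \<in> ?V - {r}" "w i \<noteq> 0"
    and w: "\<And>i. i \<in> ?V - {r} \<Longrightarrow> (\<Sum>j\<in>?V - {r}. laplacian X i j * w j) = 0"
    using fdet_eq_0_kernel[of "?V - {r}" "laplacian X"] fin by blast
  define x where "x = w(r := 0)"
  have x: "(\<Sum>j\<in>?V. laplacian X i j * x j) = (\<Sum>j\<in>?V - {r}. laplacian X i j * w j)" for i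
    using fin r by (subst sum.remove[of _ r]) (auto simp: x_def intro!: sum.cong)
  have "(\<Sum>i\<in>?V. \<Sum>j\<in>?V. laplacian X i j * x j) = (\<Sum>j\<in>?V. (\<Sum>i\<in>?V. laplacian X i j) * x j)"
    unfolding sum_distrib_right by (rule sum.swap)
  also have "\<dots> = 0" by (simp add: laplacian_col_sum)
  finally have "(\<Sum>j\<in>?V. laplacian X r j * x j) = 0"
    using fin r w x by (subst (asm) sum.remove[of _ r]) auto
  then have "(\<Sum>j\<in>?V. laplacian X u j * x j) = 0" if "u \<in> ?V" for u
    using that w x by (cases "u = r") auto
  from laplacian_kernel_constant[OF conn this, of i r] have "x i = x r"
    using i r by simp
  then show False using i by (simp add: x_def)
qed

text \<open>Separates the vertex \<open>r\<close> deleted in the Jacobian from the vertex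
  \<open>r'\<close> at which the determinant is convenient to compute.\<close>

lemma order_jacobian:
  assumes conn: "Digraph_Component.connected (with_proj X)" and r: "r \<in> pverts X" "r' \<in> pverts X"
  shows "int (Coset.order (jacobian X r)) = \<bar>fdet (pverts X - {r'}) (laplacian X)\<bar>"
proof -
  have "fdet (pverts X - {r}) (laplacian X) = fdet (pverts X - {r'}) (laplacian X)"
    using pair_finite_verts r laplacian_row_sum laplacian_col_sum by (rule fdet_delete_index)
  moreover have "int (Coset.order (jacobian X r)) = \<bar>fdet (pverts X - {r}) (laplacian X)\<bar>"
    unfolding jacobian_def using pair_finite_verts fdet_reduced_laplacian_nonzero[OF conn r(1)]
    by (intro order_cokernel) auto
  ultimately show ?thesis by simp
qed

end

section \<open>The single voltage cover\<close>

lemma lookup_mult_of_int: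
  fixes p :: "'g::comm_monoid_add \<Rightarrow>\<^sub>0 int"
  shows "Poly_Mapping.lookup (p * of_int k) e = k * Poly_Mapping.lookup p e"
proof -
  have nat: "Poly_Mapping.lookup (p * of_nat m) e = int m * Poly_Mapping.lookup p e" for m
    by (induction m) (auto simp: lookup_add distrib_left distrib_right)
  show ?thesis
    by (cases k rule: int_cases2) (simp_all add: nat)
qed

lemma fdet_of_int: "fdet S (\<lambda>i j. of_int (M i j)) = of_int (fdet S M)"
  by (simp add: fdet_def)

text \<open>Here \<open>m k\<close> is the k-th multiple of \<tau>. As \<tau> has order
  \<open>d\<close>, the first \<open>d\<close> multiples are distinct, so by counting they fill the
  group, and \<open>m d\<close> closes the cycle.\<close>

lemma cyclic_enumeration:
  fixes \<tau> :: "'g::{ab_group_add, finite}"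
  assumes gen: "generate additive_group {\<tau>} = UNIV" and card: "card (UNIV :: 'g set) = d"
  obtains m :: "nat \<Rightarrow> 'g" where "m 0 = 0" "\<And>k. m (Suc k) = m k + \<tau>"
    "bij_betw m {0..<d} UNIV" "m d = 0"
proof -
  let ?G = "additive_group :: 'g monoid"
  interpret G: group ?G
    by (rule groupI) (auto simp: additive_group_def add.assoc intro: exI[of _ "- x" for x])
  have car: "carrier ?G = UNIV" by (simp add: additive_group_def)
  then have t: "\<tau> \<in> carrier ?G" by simp
  define m where "m k = \<tau> [^]\<^bsub>?G\<^esub> k" for k :: nat
  have ord: "G.ord \<tau> = d"
    using G.generate_pow_card[OF t] gen card by simp
  have d: "d > 0" using card by (auto simp: finite_UNIV_card_ge_0)
  have inj: "inj_on m {0..<d}"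
  proof -
    have "{0..d - 1} = {0..<d}" using d by auto
    then show ?thesis using G.ord_inj[OF t] unfolding m_def ord by simp
  qed
  then have "m ` {0..<d} = UNIV"
    by (intro card_subset_eq) (simp_all add: card_image card)
  with inj have "bij_betw m {0..<d} UNIV" by (rule bij_betw_imageI)
  moreover have "m 0 = 0" "m d = 0" "\<And>k. m (Suc k) = m k + \<tau>"
    using G.pow_ord_eq_1[OF t] unfolding ord by (auto simp: m_def additive_group_def)
  ultimately show thesis using that by blast
qed

locale single_voltage_cover =
  fixes X :: "'a pair_pre_digraph" and n d :: nat and v :: "nat \<Rightarrow> 'a"
    and \<tau> :: "'g::{ab_group_add, finite}"
  assumes X_graph: "pair_graph X"
    and X_connected: "Digraph_Component.connected (with_proj X)"
    and labelling: "bij_betw v {1..n} (pverts X)"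
    and v1_adj_v2: "(v 1, v 2) \<in> parcs X"
    and tau_generates: "generate additive_group {\<tau>} = UNIV"
    and card_G: "card (UNIV :: 'g set) = d"
begin

declare One_nat_def [simp del]

interpretation pair_graph X by (rule X_graph)

abbreviation \<alpha> :: "nat \<Rightarrow> nat \<Rightarrow> 'g" where "\<alpha> \<equiv> single_voltage \<tau>"

abbreviation Y :: "(nat \<times> 'g) pair_pre_digraph" where "Y \<equiv> derived_graph X n v \<alpha>"

abbreviation W :: "nat set" where "W \<equiv> {2..n}"

definition M :: "nat \<Rightarrow> nat \<Rightarrow> int" where "M i j = laplacian X (v i) (v j)"

definition \<kappa> :: int where "\<kappa> = fdet W M"

definition adj1 :: "nat \<Rightarrow> int" where "adj1 i = (if (v 1, v i) \<in> parcs X then 1 else 0)"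

definition deg :: "nat \<Rightarrow> int" where "deg i = int (out_degree (with_proj X) (v i))"

lemma d_pos: "d > 0"
  using card_G by (auto simp: finite_UNIV_card_ge_0)

lemma v_eq_iff: "i \<in> {1..n} \<Longrightarrow> j \<in> {1..n} \<Longrightarrow> v i = v j \<longleftrightarrow> i = j"
  by (rule inj_on_eq_iff[OF bij_betw_imp_inj_on[OF labelling]])

lemma no_loop: "(u, u) \<notin> parcs X"
  using pair_no_loops[of "(u, u)"] by auto

lemma n_ge_2: "n \<ge> 2"
proof -
  have "card {v 1, v 2} \<le> card (pverts X)"
    using v1_adj_v2 in_arcsD1 in_arcsD2 pair_finite_verts by (intro card_mono) auto
  moreover have "v 1 \<noteq> v 2" using pair_no_loops[OF v1_adj_v2] by auto
  moreover have "card (pverts X) = n" using bij_betw_same_card[OF labelling] by simp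
  ultimately show ?thesis by simp
qed

lemma labels_eq: "{1..n} = insert 1 W"
  using n_ge_2 by auto

lemma M_alt:
  assumes "i \<in> {1..n}" "j \<in> {1..n}"
  shows "M i j = (if i = j then deg i else 0) - (if (v i, v j) \<in> parcs X then 1 else 0)"
  using assms by (simp add: M_def laplacian_def degree_matrix_def adjacency_matrix_def deg_def v_eq_iff)

lemma M_1: "i \<in> W \<Longrightarrow> M i 1 = - adj1 i" "i \<in> W \<Longrightarrow> M 1 i = - adj1 i"
  using n_ge_2 by (auto simp: M_alt adj1_def arc_sym[OF X_graph, of "v i" "v 1"])

lemma M_11: "M 1 1 = deg 1"
  using n_ge_2 no_loop by (auto simp: M_alt)

lemma sum_labels: "(\<Sum>i\<in>{1..n}. f (v i)) = (\<Sum>u\<in>pverts X. f u)"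
  using labelling by (rule sum.reindex_bij_betw)

lemma M_row_sum:
  assumes "i \<in> {1..n}"
  shows "M i 1 + (\<Sum>j\<in>W. M i j) = 0"
proof -
  have "v i \<in> pverts X" using assms labelling by (auto simp: bij_betw_def)
  then have "(\<Sum>j\<in>{1..n}. M i j) = 0"
    unfolding M_def using sum_labels[of "laplacian X (v i)"] laplacian_row_sum[OF X_graph] by simp
  then show ?thesis unfolding labels_eq by simp
qed

lemma M_sym: "M i j = M j i"
  by (simp add: M_def laplacian_sym[OF X_graph])

lemma deg_eq_sum: "deg 1 = (\<Sum>i\<in>W. adj1 i)"
  using M_row_sum[of 1] n_ge_2 M_1 by (simp add: M_11 sum_negf)

lemma labelling_W: "bij_betw v W (pverts X - {v 1})"
proof -
  have "W = {1..n} - {1}" by auto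
  moreover have "bij_betw v ({1..n} - {1}) (pverts X - {v 1})"
    using labelling n_ge_2 by (intro bij_betw_DiffI) (auto simp: bij_betw_def)
  ultimately show ?thesis by simp
qed

lemma \<kappa>_eq: "\<kappa> = fdet (pverts X - {v 1}) (laplacian X)"
  unfolding \<kappa>_def M_def by (rule fdet_reindex[OF labelling_W, symmetric]) simp

lemma \<kappa>_nonzero: "\<kappa> \<noteq> 0"
  unfolding \<kappa>_eq using X_graph X_connected in_arcsD1[OF v1_adj_v2]
  by (rule fdet_reduced_laplacian_nonzero)

text \<open>
  An adjugate of \<open>M\<close>, used only through these two identities.
\<close>

definition N :: "nat \<Rightarrow> nat \<Rightarrow> int" where
  "N = (SOME N. (\<forall>i\<in>W. \<forall>j\<in>W. (\<Sum>k\<in>W. M i k * N k j) = (if i = j then \<kappa> else 0)) \<and>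
     (\<forall>i\<in>W. \<forall>j\<in>W. (\<Sum>k\<in>W. N i k * M k j) = (if i = j then \<kappa> else 0)))"

lemma
  assumes "i \<in> W" "j \<in> W"
  shows M_N: "(\<Sum>k\<in>W. M i k * N k j) = (if i = j then \<kappa> else 0)"
    and N_M: "(\<Sum>k\<in>W. N i k * M k j) = (if i = j then \<kappa> else 0)"
proof -
  obtain N' where "\<And>i j. i \<in> W \<Longrightarrow> j \<in> W \<Longrightarrow> (\<Sum>k\<in>W. M i k * N' k j) = (if i = j then \<kappa> else 0)"
    "\<And>i j. i \<in> W \<Longrightarrow> j \<in> W \<Longrightarrow> (\<Sum>k\<in>W. N' i k * M k j) = (if i = j then \<kappa> else 0)"
    unfolding \<kappa>_def by (rule fdet_adjugate[of W M]) auto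
  then have "\<exists>N. (\<forall>i\<in>W. \<forall>j\<in>W. (\<Sum>k\<in>W. M i k * N k j) = (if i = j then \<kappa> else 0)) \<and>
     (\<forall>i\<in>W. \<forall>j\<in>W. (\<Sum>k\<in>W. N i k * M k j) = (if i = j then \<kappa> else 0))"
    by (intro exI[of _ N'] conjI ballI)
  from someI_ex[OF this, folded N_def] assms
  show "(\<Sum>k\<in>W. M i k * N k j) = (if i = j then \<kappa> else 0)"
    "(\<Sum>k\<in>W. N i k * M k j) = (if i = j then \<kappa> else 0)" by blast+
qed

lemma adj1_eq_sum: "k \<in> W \<Longrightarrow> adj1 k = (\<Sum>l\<in>W. M k l)"
  using M_row_sum[of k] M_1(1)[of k] by auto

text \<open>On \<open>W\<close> the vector \<open>adj1\<close> is \<open>M\<close> applied to the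
  all-ones vector, so \<open>N\<close> sends it to \<kappa> times the all-ones vector.\<close>

lemma N_row: "i \<in> W \<Longrightarrow> (\<Sum>j\<in>W. N i j * adj1 j) = \<kappa>"
proof -
  assume i: "i \<in> W"
  have "(\<Sum>j\<in>W. N i j * adj1 j) = (\<Sum>j\<in>W. \<Sum>l\<in>W. N i j * M j l)"
    by (simp add: adj1_eq_sum sum_distrib_left)
  also have "\<dots> = (\<Sum>l\<in>W. \<Sum>j\<in>W. N i j * M j l)" by (rule sum.swap)
  also have "\<dots> = \<kappa>" using i by (simp add: N_M)
  finally show ?thesis .
qed

text \<open>The transposed version, using the symmetry of \<open>M\<close>.\<close>

lemma N_col: "j \<in> W \<Longrightarrow> (\<Sum>i\<in>W. adj1 i * N i j) = \<kappa>"
proof -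
  assume j: "j \<in> W"
  have "(\<Sum>i\<in>W. adj1 i * N i j) = (\<Sum>i\<in>W. \<Sum>l\<in>W. M l i * N i j)"
    by (simp add: adj1_eq_sum sum_distrib_right M_sym)
  also have "\<dots> = (\<Sum>l\<in>W. \<Sum>i\<in>W. M l i * N i j)" by (rule sum.swap)
  also have "\<dots> = \<kappa>" using j by (simp add: M_N)
  finally show ?thesis .
qed

text \<open>
  The Schur complement of vertex \<open>v\<^sub>1\<close>, once the denominator \<open>\<kappa>\<close> is cleared, is the group ring element
  with these coefficients.
\<close>

definition \<theta> :: "'g \<Rightarrow> int" where
  "\<theta> e = (if e = 0 then \<kappa> * deg 1 else 0)
     - (\<Sum>i\<in>W. \<Sum>j\<in>W. if e = \<alpha> 1 i + \<alpha> j 1 then adj1 i * N i j * adj1 j else 0)"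

text \<open>The total of \<open>adj1 i * N i j * adj1 j\<close> over i = 2 and j \<noteq> 2: by
  \<open>N_row\<close> the whole row contributes \<kappa>, and the diagonal term is
  \<open>N 2 2\<close>.\<close>

definition c :: int where "c = \<kappa> - N 2 2"

text \<open>A pair (i, j) contributes at \<tau> if only i is 2, at \<open>- \<tau>\<close> if only j
  is 2, and at 0 otherwise, since the voltages cancel for i = j = 2. The first two totals are both
  \<open>c\<close>, and all pairs together weigh \<open>\<kappa> * deg 1\<close>, which leaves
  \<open>2 * c\<close> at 0.\<close>

lemma \<theta>_eq: "\<theta> e = c * ((if e = 0 then 2 else 0) - (if e = \<tau> then 1 else 0) - (if e = - \<tau> then 1 else 0))"
proof -
  let ?T = "\<lambda>i j. adj1 i * N i j * adj1 j"
  \<comment> \<open>Three separate indicators, since 0, \<tau> and \<open>- \<tau>\<close> may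
    coincide in a small group.\<close>
  define z t s where "z = (if e = 0 then 1 else 0 :: int)"
    and "t = (if e = \<tau> then 1 else 0 :: int)" and "s = (if e = - \<tau> then 1 else 0 :: int)"
  let ?p = "\<lambda>i j. (if i = 2 then ?T i j else 0) - (if j = 2 then if i = 2 then ?T i j else 0 else 0)"
  let ?q = "\<lambda>i j. (if j = 2 then ?T i j else 0) - (if j = 2 then if i = 2 then ?T i j else 0 else 0)"
  have W2: "2 \<in> W" "finite W" using n_ge_2 by auto
  have a2: "adj1 2 = 1" using v1_adj_v2 by (simp add: adj1_def)
  have "(\<Sum>i\<in>W. \<Sum>j\<in>W. if i = 2 then ?T i j else 0) = \<kappa>"
    using N_row[OF W2(1)] a2 W2 by (subst sum.swap) simp
  then have p: "(\<Sum>i\<in>W. \<Sum>j\<in>W. ?p i j) = c"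
    using W2 a2 by (simp add: sum_subtractf c_def)
  have "(\<Sum>i\<in>W. ?T i 2) = \<kappa>"
    using N_col[OF W2(1)] a2 by simp
  then have q: "(\<Sum>i\<in>W. \<Sum>j\<in>W. ?q i j) = c"
    using W2 a2 by (simp add: sum_subtractf c_def)
  have "(\<Sum>i\<in>W. \<Sum>j\<in>W. ?T i j) = (\<Sum>i\<in>W. adj1 i * (\<Sum>j\<in>W. N i j * adj1 j))"
    by (simp add: sum_distrib_left mult.assoc)
  also have "\<dots> = (\<Sum>i\<in>W. adj1 i * \<kappa>)"
    by (intro sum.cong refl) (simp only: N_row)
  also have "\<dots> = \<kappa> * deg 1"
    by (simp add: deg_eq_sum sum_distrib_left mult.commute)
  finally have all: "(\<Sum>i\<in>W. \<Sum>j\<in>W. ?T i j) = \<kappa> * deg 1" .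
  have "(\<Sum>i\<in>W. \<Sum>j\<in>W. if e = \<alpha> 1 i + \<alpha> j 1 then ?T i j else 0)
      = (\<Sum>i\<in>W. \<Sum>j\<in>W. z * ?T i j + (t - z) * ?p i j + (s - z) * ?q i j)"
  proof (intro sum.cong refl)
    fix i j assume "i \<in> W" "j \<in> W"
    then have "\<alpha> 1 i = (if i = 2 then \<tau> else 0)" "\<alpha> j 1 = (if j = 2 then - \<tau> else 0)"
      by (auto simp: single_voltage_def)
    then show "(if e = \<alpha> 1 i + \<alpha> j 1 then ?T i j else 0) = z * ?T i j + (t - z) * ?p i j + (s - z) * ?q i j"
      by (simp add: z_def t_def s_def)
  qed
  also have "\<dots> = z * (\<Sum>i\<in>W. \<Sum>j\<in>W. ?T i j) + (t - z) * (\<Sum>i\<in>W. \<Sum>j\<in>W. ?p i j)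
      + (s - z) * (\<Sum>i\<in>W. \<Sum>j\<in>W. ?q i j)"
    by (simp only: sum.distrib sum_distrib_left)
  also have "\<dots> = z * (\<kappa> * deg 1) + (t - z) * c + (s - z) * c"
    by (simp only: all p q)
  finally have "\<theta> e = z * (\<kappa> * deg 1) - (z * (\<kappa> * deg 1) + (t - z) * c + (s - z) * c)"
    unfolding \<theta>_def by (simp add: z_def)
  also have "\<dots> = c * (2 * z - t - s)"
    by (simp add: algebra_simps)
  finally show ?thesis by (simp add: z_def t_def s_def)
qed

text \<open>Voltages between labels in \<open>W\<close> are trivial, so the block of
  \<open>P\<close> on \<open>W\<close> is the integer matrix \<open>M\<close> and \<open>N\<close>
  serves as its adjugate over the group ring as well.\<close>

lemma stickelberger_coeff: "Poly_Mapping.lookup (reduced_stickelberger X n v \<alpha>) e = \<theta> e"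
proof -
  define P :: "nat \<Rightarrow> nat \<Rightarrow> 'g \<Rightarrow>\<^sub>0 int" where
    "P i j = of_int (degree_matrix X (v i) (v j)) -
      (if (v i, v j) \<in> parcs X then Poly_Mapping.single (\<alpha> i j) 1 else 0)" for i j
  let ?\<Theta> = "reduced_stickelberger X n v \<alpha>"
  have "bij_betw Suc {0..<n} {1..n}"
    by (auto simp: bij_betw_def image_Suc_atLeastLessThan atLeastLessThanSuc_atLeastAtMost)
  then have "fdet {1..n} P = det (index_mat Suc n P)" by (rule fdet_eq_det)
  moreover have "index_mat Suc n P = group_ring_degree_mat X n v - voltage_adjacency_mat X n v \<alpha>"
    by (rule eq_matI)
       (auto simp: index_mat_def group_ring_degree_mat_def voltage_adjacency_mat_def P_def)
  ultimately have det: "?\<Theta> = fdet ({1} \<union> W) P"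
    by (simp add: reduced_stickelberger_def labels_eq)
  have PW: "P i j = of_int (M i j)" if "i \<in> W" "j \<in> W" for i j
    using that by (auto simp: P_def M_def laplacian_def adjacency_matrix_def single_voltage_def single_one)
  have P1: "P 1 j = - (if (v 1, v j) \<in> parcs X then Poly_Mapping.single (\<alpha> 1 j) 1 else 0)"
    if "j \<in> W" for j
    using that v_eq_iff[of 1 j] n_ge_2 by (auto simp: P_def degree_matrix_def)
  have P1': "P j 1 = - (if (v 1, v j) \<in> parcs X then Poly_Mapping.single (\<alpha> j 1) 1 else 0)"
    if "j \<in> W" for j
    using that v_eq_iff[of j 1] n_ge_2
    by (auto simp: P_def degree_matrix_def arc_sym[OF X_graph, of "v j" "v 1"])
  have P11: "P 1 1 = of_int (deg 1)"
    using no_loop by (auto simp: P_def degree_matrix_def deg_def)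
  \<comment> \<open>The two minus signs cancel, and the product in the group ring adds the two
    voltages.\<close>
  have summand: "P 1 i * of_int (N i j) * P j 1
      = Poly_Mapping.single (\<alpha> 1 i + \<alpha> j 1) (adj1 i * N i j * adj1 j)" if "i \<in> W" "j \<in> W" for i j
  proof -
    have "of_int (N i j) = Poly_Mapping.single (0 :: 'g) (N i j)"
      by (rule poly_mapping_eqI) (simp add: lookup_of_int lookup_single)
    then show ?thesis
      using that by (simp add: P1 P1' adj1_def mult_single)
  qed
  have "fdet ({1} \<union> W) P * of_int \<kappa> ^ card {1::nat}
      = fdet {1} (\<lambda>a a'. of_int \<kappa> * P a a' - (\<Sum>b\<in>W. \<Sum>b'\<in>W. P a b * of_int (N b b') * P b' a')) * fdet W P"
  proof (rule fdet_schur_complement)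
    show "(\<Sum>b\<in>W. P i b * of_int (N b j)) = (if i = j then of_int \<kappa> else 0)"
      if "i \<in> W" "j \<in> W" for i j
    proof -
      have "(\<Sum>b\<in>W. P i b * of_int (N b j)) = of_int (\<Sum>b\<in>W. M i b * N b j)"
        using that by (simp add: PW)
      also have "\<dots> = of_int (if i = j then \<kappa> else 0)"
        by (simp only: M_N[OF that])
      finally show ?thesis by simp
    qed
  qed auto
  moreover have "fdet W P = of_int \<kappa>"
    unfolding \<kappa>_def fdet_of_int[symmetric] by (rule fdet_cong) (simp add: PW)
  moreover have "(\<Sum>b\<in>W. \<Sum>b'\<in>W. P 1 b * of_int (N b b') * P b' 1)
      = (\<Sum>i\<in>W. \<Sum>j\<in>W. Poly_Mapping.single (\<alpha> 1 i + \<alpha> j 1) (adj1 i * N i j * adj1 j))"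
    by (intro sum.cong refl) (rule summand)
  ultimately have "?\<Theta> * of_int \<kappa> = (of_int (\<kappa> * deg 1) - (\<Sum>i\<in>W. \<Sum>j\<in>W.
      Poly_Mapping.single (\<alpha> 1 i + \<alpha> j 1) (adj1 i * N i j * adj1 j))) * of_int \<kappa>"
    by (simp add: det P11)
  \<comment> \<open>The group ring may have zero divisors; comparing coefficients turns the factor
    \<kappa> into a nonzero integer that can be cancelled.\<close>
  from arg_cong[where f = "\<lambda>p. Poly_Mapping.lookup p e", OF this]
  have "Poly_Mapping.lookup ?\<Theta> e = Poly_Mapping.lookup (of_int (\<kappa> * deg 1) - (\<Sum>i\<in>W. \<Sum>j\<in>W.
      Poly_Mapping.single (\<alpha> 1 i + \<alpha> j 1) (adj1 i * N i j * adj1 j))) e"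
    using \<kappa>_nonzero by (simp only: lookup_mult_of_int mult_cancel_left) simp
  moreover have "Poly_Mapping.lookup (Poly_Mapping.single g x) e = (if e = g then x else 0)" for g and x :: int
    by (auto simp: lookup_single when_def)
  ultimately show ?thesis
    by (simp add: \<theta>_def lookup_minus lookup_sum lookup_of_int when_def del: of_int_mult)
qed

section \<open>The derived graph and its reduced Laplacian\<close>

lemma Y_adj: "((i, g), (j, h)) \<in> parcs Y \<longleftrightarrow>
    i \<in> {1..n} \<and> j \<in> {1..n} \<and> (v i, v j) \<in> parcs X \<and> h = g + \<alpha> i j"
  by (auto simp: derived_graph_def)

lemma pverts_Y: "pverts Y = {1..n} \<times> UNIV"
  by (simp add: derived_graph_def)

lemma \<alpha>_swap: "\<alpha> j i = - \<alpha> i j"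
  by (auto simp: single_voltage_def)

text \<open>Arcs can be reversed because opposite voltages are inverse to each other, and a loop
  would lie over a loop of \<open>X\<close>.\<close>

lemma Y_graph: "pair_graph Y"
proof
  show "finite (pverts Y)" by (simp add: pverts_Y)
  have "parcs Y \<subseteq> pverts Y \<times> pverts Y" by (auto simp: derived_graph_def)
  then show "finite (parcs Y)" by (rule finite_subset) (simp add: pverts_Y)
  show "fst e \<in> pverts Y" "snd e \<in> pverts Y" if "e \<in> parcs Y" for e
    using that by (auto simp: derived_graph_def)
  have "((j, h), (i, g)) \<in> parcs Y" if "((i, g), (j, h)) \<in> parcs Y" for i g j h
    using that arc_sym[OF X_graph, of "v i" "v j"] by (simp add: Y_adj \<alpha>_swap[of j i])
  then show "symmetric (with_proj Y)"
    unfolding symmetric_def with_proj_simps by (intro symI) (metis surj_pair)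
  show "fst e \<noteq> snd e" if "e \<in> parcs Y" for e
    using that no_loop by (auto simp: derived_graph_def)
qed

text \<open>Projection to \<open>X\<close> is bijective on neighbours, since the label of a
  neighbour determines its group element.\<close>

lemma out_degree_Y:
  assumes "i \<in> {1..n}"
  shows "int (out_degree (with_proj Y) (i, g)) = deg i"
proof -
  have "bij_betw (\<lambda>(j, h). v j) {w. ((i, g), w) \<in> parcs Y} {u. (v i, u) \<in> parcs X}"
  proof (rule bij_betw_imageI)
    show "inj_on (\<lambda>(j, h). v j) {w. ((i, g), w) \<in> parcs Y}"
      by (auto simp: inj_on_def Y_adj v_eq_iff)
    show "(\<lambda>(j, h). v j) ` {w. ((i, g), w) \<in> parcs Y} = {u. (v i, u) \<in> parcs X}"
    proof (intro equalityI subsetI)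
      fix u assume "u \<in> {u. (v i, u) \<in> parcs X}"
      moreover from this obtain j where "j \<in> {1..n}" "u = v j"
        using in_arcsD2[of "v i" u] bij_betw_imp_surj_on[OF labelling] by blast
      ultimately show "u \<in> (\<lambda>(j, h). v j) ` {w. ((i, g), w) \<in> parcs Y}"
        using assms by (intro image_eqI[of _ _ "(j, g + \<alpha> i j)"]) (auto simp: Y_adj)
    qed (auto simp: Y_adj)
  qed
  then show ?thesis
    by (simp add: out_degree_with_proj deg_def bij_betw_same_card)
qed

lemma laplacian_Y:
  assumes "i \<in> {1..n}" "j \<in> {1..n}"
  shows "laplacian Y (i, g) (j, h) = (if i = j \<and> g = h then deg i else 0)
      - (if (v i, v j) \<in> parcs X \<and> h = g + \<alpha> i j then 1 else 0)"
  using assms by (simp add: laplacian_def degree_matrix_def adjacency_matrix_def Y_adj out_degree_Y)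

text \<open>Listing the nonzero group elements as successive multiples of \<tau> makes the matrix
  \<open>c\<close> times the tridiagonal one of \<open>fdet_path_matrix\<close>; omitting 0 cuts the
  cycle open.\<close>

lemma fdet_cycle:
  "fdet ({1::nat} \<times> (UNIV - {0})) (\<lambda>x y. \<theta> (snd y - snd x)) = c ^ (d - 1) * int d"
proof -
  obtain m :: "nat \<Rightarrow> 'g" where m: "m 0 = 0" "\<And>k. m (Suc k) = m k + \<tau>"
    "bij_betw m {0..<d} UNIV" "m d = 0"
    using cyclic_enumeration[OF tau_generates card_G] by blast
  have inj: "m k = m l \<longleftrightarrow> k = l" if "k < d" "l < d" for k l
    using that inj_on_eq_iff[OF bij_betw_imp_inj_on[OF m(3)], of k l] by simp
  note d = d_pos
  have "bij_betw m ({0..<d} - {0}) (UNIV - {0})"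
    using m(3) m(1) d by (intro bij_betw_DiffI) (auto simp: bij_betw_def)
  moreover have "{0..<d} - {0} = {1..d - 1}" using d by auto
  moreover have "bij_betw (Pair (1::nat)) (UNIV - {0 :: 'g}) ({1} \<times> (UNIV - {0}))"
    by (auto simp: bij_betw_def inj_on_def)
  ultimately have "bij_betw (Pair (1::nat) \<circ> m) {1..d - 1} ({1} \<times> (UNIV - {0}))"
    by (auto intro: bij_betw_trans)
  then have "fdet ({1::nat} \<times> (UNIV - {0})) (\<lambda>x y. \<theta> (snd y - snd x))
      = fdet {1..d - 1} (\<lambda>k l. \<theta> (m l - m k))"
    by (subst fdet_reindex) auto
  also have "\<dots> = fdet {1..d - 1}
      (\<lambda>k l. c * (if k = l then 2 else if l = Suc k \<or> k = Suc l then - 1 else 0))"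
  proof (rule fdet_cong)
    fix k l assume "k \<in> {1..d - 1}" "l \<in> {1..d - 1}"
    then have kl: "k \<noteq> 0" "l \<noteq> 0" "k < d" "l < d" using d by auto
    \<comment> \<open>The only wrap-around is from the last multiple to 0, which
      \<open>i \<noteq> 0\<close> excludes.\<close>
    have succ: "m i = m j + \<tau> \<longleftrightarrow> i = Suc j" if "i \<noteq> 0" "i < d" "j < d" for i j
    proof (cases "Suc j = d")
      case True
      then have "m j + \<tau> = m 0" using m by metis
      then show ?thesis using inj[of i 0] that True by auto
    next
      case False
      then show ?thesis using inj[of i "Suc j"] that m(2)[of j] by auto
    qed
    have "m l - m k = 0 \<longleftrightarrow> k = l" using inj kl by auto
    moreover have "m l - m k = \<tau> \<longleftrightarrow> l = Suc k"
      using succ[of l k] kl by (auto simp: algebra_simps)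
    moreover have "m l - m k = - \<tau> \<longleftrightarrow> k = Suc l"
      using succ[of k l] kl by (auto simp: algebra_simps)
    ultimately show "\<theta> (m l - m k) = c * (if k = l then 2 else if l = Suc k \<or> k = Suc l then - 1 else 0)"
      by (auto simp: \<theta>_eq)
  qed
  also have "\<dots> = c ^ (d - 1) * int d"
    using d by (simp add: fdet_smult fdet_path_matrix)
  finally show ?thesis .
qed

lemma fdet_reduced_laplacian_Y:
  "fdet (pverts Y - {(1, 0)}) (laplacian Y) = \<kappa> * c ^ (d - 1) * int d"
proof -
  let ?A = "{1::nat} \<times> (UNIV - {0 :: 'g})" and ?B = "W \<times> (UNIV :: 'g set)"
  let ?L = "laplacian Y"
  \<comment> \<open>One copy of \<open>N\<close> in each layer of constant group element, matching
    the block structure of the Laplacian on \<open>?B\<close>.\<close>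
  define R :: "nat \<times> 'g \<Rightarrow> nat \<times> 'g \<Rightarrow> int" where
    "R x y = (if snd x = snd y then N (fst x) (fst y) else 0)" for x y
  have V: "pverts Y - {(1, 0)} = ?A \<union> ?B"
    unfolding pverts_Y labels_eq by auto
  have LB: "?L (i, g) (j, h) = (if g = h then M i j else 0)" if "i \<in> W" "j \<in> W" for i j g h
    using that by (auto simp: laplacian_Y M_alt single_voltage_def)
  have L1: "?L (1, g) (i, h) = (if h = g + \<alpha> 1 i then - adj1 i else 0)"
    "?L (i, g) (1, h) = (if g = h - \<alpha> i 1 then - adj1 i else 0)" if "i \<in> W" for i g h
    using that n_ge_2
    by (auto simp: laplacian_Y adj1_def arc_sym[OF X_graph, of "v i" "v 1"] algebra_simps)
  have L11: "?L (1, g) (1, h) = (if g = h then deg 1 else 0)" for g h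
    using n_ge_2 no_loop by (auto simp: laplacian_Y)
  have schur: "fdet (?A \<union> ?B) ?L * \<kappa> ^ card ?A
      = fdet ?A (\<lambda>a a'. \<kappa> * ?L a a' - (\<Sum>b\<in>?B. \<Sum>b'\<in>?B. ?L a b * R b b' * ?L b' a')) * fdet ?B ?L"
  proof (rule fdet_schur_complement)
    show "(\<Sum>b\<in>?B. ?L x b * R b y) = (if x = y then \<kappa> else 0)" if xy: "x \<in> ?B" "y \<in> ?B" for x y
    proof -
      obtain i g j h where x: "x = (i, g)" "i \<in> W" and y: "y = (j, h)" "j \<in> W"
        using xy by auto
      have "(\<Sum>b\<in>?B. ?L x b * R b y) = (\<Sum>k\<in>W. \<Sum>g'\<in>UNIV. if g' = g then if g = h then M i k * N k j else 0 else 0)"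
        unfolding sum.cartesian_product' x(1) y(1)
        by (intro sum.cong refl) (use x y in \<open>auto simp: LB R_def\<close>)
      also have "\<dots> = (if x = y then \<kappa> else 0)"
        using x y M_N[of i j] by (cases "g = h") auto
      finally show ?thesis .
    qed
  qed (auto simp: finite_cartesian_product)
  \<comment> \<open>A term survives only if both middle indices lie in one layer g' with g' = g +
    \<open>\<alpha> 1 i\<close> = h - \<open>\<alpha> j 1\<close>. Such a g' exists exactly when h -
    g = \<open>\<alpha> 1 i + \<alpha> j 1\<close>, the condition in \<theta>.\<close>
  have entry: "\<kappa> * ?L (1, g) (1, h) - (\<Sum>b\<in>?B. \<Sum>b'\<in>?B. ?L (1, g) b * R b b' * ?L b' (1, h)) = \<theta> (h - g)" for g h
  proof -
    have "(\<Sum>b\<in>?B. \<Sum>b'\<in>?B. ?L (1, g) b * R b b' * ?L b' (1, h))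
        = (\<Sum>i\<in>W. \<Sum>g'\<in>UNIV. \<Sum>j\<in>W. \<Sum>g''\<in>UNIV. ?L (1, g) (i, g') * R (i, g') (j, g'') * ?L (j, g'') (1, h))"
      by (simp only: sum.cartesian_product')
    also have "\<dots> = (\<Sum>i\<in>W. \<Sum>g'\<in>UNIV. \<Sum>j\<in>W. \<Sum>g''\<in>UNIV. if g'' = g' then
        if g' = g + \<alpha> 1 i then if g' = h - \<alpha> j 1 then adj1 i * N i j * adj1 j else 0 else 0 else 0)"
      by (intro sum.cong refl) (auto simp: L1 R_def)
    also have "\<dots> = (\<Sum>i\<in>W. \<Sum>j\<in>W. \<Sum>g'\<in>UNIV. 
        if g' = g + \<alpha> 1 i then if g' = h - \<alpha> j 1 then adj1 i * N i j * adj1 j else 0 else 0)"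
      by (subst sum.swap[where B = W]) simp
    also have "\<dots> = (\<Sum>i\<in>W. \<Sum>j\<in>W. if h - g = \<alpha> 1 i + \<alpha> j 1 then adj1 i * N i j * adj1 j else 0)"
      by (intro sum.cong refl) (auto simp: algebra_simps)
    finally show ?thesis
      unfolding \<theta>_def L11 by auto
  qed
  have "fdet ?A (\<lambda>a a'. \<kappa> * ?L a a' - (\<Sum>b\<in>?B. \<Sum>b'\<in>?B. ?L a b * R b b' * ?L b' a'))
      = fdet ?A (\<lambda>x y. \<theta> (snd y - snd x))"
    by (rule fdet_cong) (auto simp: entry)
  moreover have "fdet ?B ?L = fdet ?B (\<lambda>x y. if snd x = snd y then M (fst x) (fst y) else 0)"
    by (rule fdet_cong) (auto simp: LB)
  moreover have "card ?A = d - 1"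
    by (simp add: card_cartesian_product card_Diff_singleton card_G)
  \<comment> \<open>The \<open>d\<close> layers give \<open>\<kappa> ^ d\<close>, while clearing
    denominators on the \<open>d - 1\<close> remaining fibre vertices costs
    \<open>\<kappa> ^ (d - 1)\<close>; one factor \<kappa> is left over.\<close>
  moreover have "\<kappa> ^ d = \<kappa> * \<kappa> ^ (d - 1)"
    using d_pos by (simp add: power_eq_if)
  ultimately have "fdet (?A \<union> ?B) ?L * \<kappa> ^ (d - 1) = \<kappa> * c ^ (d - 1) * int d * \<kappa> ^ (d - 1)"
    using schur by (simp add: fdet_cycle fdet_block_diagonal \<kappa>_def[symmetric] card_G mult_ac)
  then show ?thesis
    unfolding V using \<kappa>_nonzero by simp
qed

text \<open>
  For \<open>d \<ge> 3\<close> the elements \<open>0\<close>, \<open>\<tau>\<close>, \<open>- \<tau>\<close> are distinct, so \<open>- c\<close> is one of the coefficients; for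
  \<open>d = 1\<close> both powers are \<open>1\<close>.
\<close>

lemma coeff_gcd_power:
  assumes "d \<noteq> 2"
  shows "\<bar>coeff_gcd (reduced_stickelberger X n v \<alpha>)\<bar> ^ (d - 1) = \<bar>c\<bar> ^ (d - 1)"
proof (cases "d = 1")
  case False
  obtain m :: "nat \<Rightarrow> 'g" where m: "m 0 = 0" "\<And>k. m (Suc k) = m k + \<tau>"
    "bij_betw m {0..<d} UNIV"
    using cyclic_enumeration[OF tau_generates card_G] by blast
  have d: "d > 2" using False assms d_pos by simp
  have inj: "m k = m l \<longleftrightarrow> k = l" if "k < d" "l < d" for k l
    using that inj_on_eq_iff[OF bij_betw_imp_inj_on[OF m(3)], of k l] by simp
  have "\<tau> \<noteq> 0" using inj[of 1 0] d m(1) m(2)[of 0] by (auto simp: One_nat_def)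
  \<comment> \<open>\<open>m 2\<close> is twice \<tau>, and it differs from \<open>m 0\<close>
    because \<open>d > 2\<close>.\<close>
  moreover have "\<tau> \<noteq> - \<tau>"
    using inj[of 2 0] d m(1) m(2)[of 0] m(2)[of 1] by (auto simp: numeral_2_eq_2 One_nat_def eq_neg_iff_add_eq_0)
  ultimately have "\<theta> \<tau> = - c" by (simp add: \<theta>_eq)
  moreover have coeff: "coeff_gcd (reduced_stickelberger X n v \<alpha>) = Gcd (range \<theta>)"
    unfolding coeff_gcd_def by (simp add: stickelberger_coeff[abs_def])
  moreover have "c dvd Gcd (range \<theta>)"
    by (rule Gcd_greatest) (auto simp: \<theta>_eq)
  moreover have "Gcd (range \<theta>) dvd \<theta> \<tau>" by (rule Gcd_dvd) simp
  ultimately have "\<bar>coeff_gcd (reduced_stickelberger X n v \<alpha>)\<bar> = \<bar>c\<bar>"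
    by (simp add: zdvd_antisym_abs)
  then show ?thesis by simp
qed simp

end

theorem corollary1:
  fixes X :: "'a pair_pre_digraph"
    and n d :: nat
    and v :: "nat \<Rightarrow> 'a"
    and \<tau> :: "'g::{ab_group_add, finite}"
    and Y :: "(nat \<times> 'g) pair_pre_digraph"
    and K :: int
    and r :: 'a
    and s :: "nat \<times> 'g"
  assumes X_graph: "pair_graph X"
    and X_connected: "Digraph_Component.connected (with_proj X)"
    and edges_neq_verts: "card (edge_set X) \<noteq> card (pverts X)"
    and labelling: "bij_betw v {1..n} (pverts X)"
    and v1_adj_v2: "(v 1, v 2) \<in> parcs X"
    and tau_generates: "generate additive_group {\<tau>} = UNIV"
    and card_G: "card (UNIV :: 'g set) = d"
    and d_neq_2: "d \<noteq> 2"
    and Y_def: "Y = derived_graph X n v (single_voltage \<tau>)"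
    and Y_connected: "Digraph_Component.connected (with_proj Y)"
    and K_def: "K = coeff_gcd (reduced_stickelberger X n v (single_voltage \<tau>))"
    and r_vert: "r \<in> pverts X"
    and s_vert: "s \<in> pverts Y"
  shows "int (Coset.order (jacobian Y s)) = int (Coset.order (jacobian X r)) * \<bar>K\<bar> ^ (d - 1) * int d"
proof -
  interpret single_voltage_cover X n d v \<tau>
    by (rule single_voltage_cover.intro) fact+
  \<comment> \<open>The arbitrary deleted vertices \<open>r\<close> and \<open>s\<close> are
    exchanged for \<open>v 1\<close> and \<open>(1, 0)\<close>, where the determinants are
    known.\<close>
  have "v 1 \<in> pverts X"
    using labelling n_ge_2 by (auto simp: bij_betw_def)
  then have X: "int (Coset.order (jacobian X r)) = \<bar>\<kappa>\<bar>"
    unfolding \<kappa>_eq using r_vert by (intro order_jacobian[OF X_graph X_connected])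
  have "(1, 0) \<in> pverts Y"
    using n_ge_2 by (simp add: Y_def pverts_Y)
  then have "int (Coset.order (jacobian Y s)) = \<bar>fdet (pverts Y - {(1, 0)}) (laplacian Y)\<bar>"
    using Y_graph Y_connected s_vert by (intro order_jacobian) (auto simp: Y_def)
  also have "\<dots> = \<bar>\<kappa>\<bar> * \<bar>c\<bar> ^ (d - 1) * int d"
    unfolding Y_def fdet_reduced_laplacian_Y by (simp add: abs_mult power_abs)
  also have "\<bar>c\<bar> ^ (d - 1) = \<bar>K\<bar> ^ (d - 1)"
    using coeff_gcd_power d_neq_2 unfolding K_def by simp
  finally show ?thesis using X by simp
qed

end
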